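(* Let $L$ be a Lagrangian satisfying the following Lipschitz condition: for every $R>0$ there is $C\ge0$ such that $|L(x,y_1,p)-L(x,y_2,p)|\le C|y_1-y_2|$ whenever $|x|,|y_1|,|y_2|,|p|\le R$. Then for each $R>0$ there are $M,\delta>0$ such that if 1. $[\alpha,\beta]\subset[a,b]\subset[-R,R]$ with $\alpha<\beta$ and $|b-a|<\delta$, and 2. $u\in AC[a,b]$ satisfies $|u(x)|\le R$ for $x\in[a,b]$ and $$\mathcal{E}(u;a,b)+|u(\beta)-u(\alpha)|\le R(\beta-\alpha),$$ then $$\int_{\{x\in[a,b]:|u'(x)|>M\}}L(x,u(x),u'(x))\,dx\le2\,\mathcal{E}(u;a,b).$$
   Context: A function $\omega\colon\mathbb{R}\to\mathbb{R}$ is superlinear if $\lim_{|p|\to\infty}\omega(p)/|p|=\infty$. A Lagrangian is a function $L\colon\mathbb{R}^3\to\mathbb{R}$ that is Borel measurable, bounded from below, locally bounded from above, and for which there is a superlinear function $\omega\colon\mathbb{R}\to\mathbb{R}$ with $L(x,y,p)\ge\omega(p)$ for all $(x,y,p)\in\mathbb{R}^3$. $AC[a,b]$ denotes the absolutely continuous real-valued functions on $[a,b]$. For $a<b$ and $u\in AC[a,b]$ put $\mathcal{L}(u;a,b)=\int_a^b L(x,u(x),u'(x))\,dx\in(-\infty,\infty]$, $\mathcal{L}(a,A;b,B)=\inf\{\mathcal{L}(v;a,b):v\in AC[a,b],\ v(a)=A,\ v(b)=B\}$, and define the excess $\mathcal{E}(u;a,b)=\mathcal{L}(u;a,b)-\mathcal{L}(a,u(a);b,u(b))$.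 *)

theory Defs
  imports "HOL-Analysis.Analysis"
begin

definition superlinear :: "(real \<Rightarrow> real) \<Rightarrow> bool" where
  "superlinear \<omega> \<longleftrightarrow> filterlim (\<lambda>p. \<omega> p / \<bar>p\<bar>) at_top at_infinity"

definition lagrangian :: "(real \<times> real \<times> real \<Rightarrow> real) \<Rightarrow> bool" where
  "lagrangian L \<longleftrightarrow>
     L \<in> borel_measurable borel \<and>
     (\<exists>m. \<forall>z. m \<le> L z) \<and>
     (\<forall>z. \<exists>B. \<forall>\<^sub>F w in nhds z. L w \<le> B) \<and>
     (\<exists>\<omega>. superlinear \<omega> \<and> (\<forall>x y p. \<omega> p \<le> L (x, y, p)))"

definition loc_lipschitz_in_y :: "(real \<times> real \<times> real \<Rightarrow> real) \<Rightarrow> bool" where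
  "loc_lipschitz_in_y L \<longleftrightarrow>
     (\<forall>R>0. \<exists>C\<ge>0. \<forall>x y1 y2 p.
        \<bar>x\<bar> \<le> R \<and> \<bar>y1\<bar> \<le> R \<and> \<bar>y2\<bar> \<le> R \<and> \<bar>p\<bar> \<le> R \<longrightarrow>
        \<bar>L (x, y1, p) - L (x, y2, p)\<bar> \<le> C * \<bar>y1 - y2\<bar>)"

text \<open>Elements of \<open>AC[a,b]\<close> are represented by total functions; only the values on
  \<open>{a..b}\<close> matter.\<close>

definition AC :: "real \<Rightarrow> real \<Rightarrow> (real \<Rightarrow> real) set" where
  "AC a b = {u. \<forall>\<epsilon>>0. \<exists>\<delta>>0. \<forall>(I :: nat set) c d.
     finite I \<and> (\<forall>i\<in>I. a \<le> c i \<and> c i \<le> d i \<and> d i \<le> b) \<and>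
     disjoint_family_on (\<lambda>i. {c i<..<d i}) I \<and> (\<Sum>i\<in>I. d i - c i) < \<delta> \<longrightarrow>
     (\<Sum>i\<in>I. \<bar>u (d i) - u (c i)\<bar>) < \<epsilon>}"

text \<open>The extended-valued Lebesgue integral, as the integral of the positive part minus that of
  the negative part (\<^const>\<open>ennreal\<close> sends negative reals to \<open>0\<close>).  It is used only for integrands
  bounded below on bounded sets, for which the subtracted term is finite.\<close>

definition ext_integral :: "real set \<Rightarrow> (real \<Rightarrow> real) \<Rightarrow> ereal" where
  "ext_integral S f =
     enn2ereal (\<integral>\<^sup>+x\<in>S. ennreal (f x) \<partial>lebesgue) - enn2ereal (\<integral>\<^sup>+x\<in>S. ennreal (- f x) \<partial>lebesgue)"

text \<open>For \<open>u\<close> in \<open>AC a b\<close>, \<open>deriv u\<close> is the derivative at almost every point of \<open>{a..b}\<close>;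
  its value at the remaining points does not affect the integrals below.\<close>

definition action :: "(real \<times> real \<times> real \<Rightarrow> real) \<Rightarrow> (real \<Rightarrow> real) \<Rightarrow> real \<Rightarrow> real \<Rightarrow> ereal" where
  "action L u a b = ext_integral {a..b} (\<lambda>x. L (x, u x, deriv u x))"

definition min_action ::
  "(real \<times> real \<times> real \<Rightarrow> real) \<Rightarrow> real \<Rightarrow> real \<Rightarrow> real \<Rightarrow> real \<Rightarrow> ereal" where
  "min_action L a A b B = (INF v \<in> {v \<in> AC a b. v a = A \<and> v b = B}. action L v a b)"

definition excess :: "(real \<times> real \<times> real \<Rightarrow> real) \<Rightarrow> (real \<Rightarrow> real) \<Rightarrow> real \<Rightarrow> real \<Rightarrow> ereal" where
  "excess L u a b = action L u a b - min_action L a (u a) b (u b)"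

end

theory Submission
  imports Defs
begin

text \<open>
  Let \<open>S\<close> be the set of points of \<open>{a..b}\<close> where the slope of \<open>u\<close> exceeds \<open>M\<close> in absolute
  value (as in all bounds on slopes below), and let
  \<open>I = \<integral>\<^sub>S \<bar>u'\<bar>\<close>.  Superlinearity gives \<open>\<integral>\<^sub>S L(x, u, u') \<ge> K * I\<close>, with \<open>K\<close> as large as desired
  once \<open>M\<close> is large.  So it suffices to find a competitor that saves \<open>\<integral>\<^sub>S L(x, u, u')\<close> at a cost of
  at most \<open>(K / 2) * I\<close>: then the excess is at least half of that integral.

  The competitor (lemma \<open>truncation_competitor\<close>) has slope \<open>0\<close> on \<open>S\<close>; to keep the end value, its slope
  differs from that of \<open>u\<close> by \<open>\<plusminus>1\<close> on a set \<open>G\<close> of measure at most \<open>I\<close>, chosen where \<open>u\<close> has slope at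
  most some \<open>N\<close>.  The cost on \<open>S\<close> and on \<open>G\<close> is \<open>I\<close> times a constant depending on \<open>N\<close> but not on
  \<open>M\<close>.  Elsewhere the slope is unchanged and the competitor differs from \<open>u\<close> by at most \<open>2 * I\<close>, so the
  Lipschitz condition bounds the cost by \<open>2 * C * I * (b - a)\<close>, where \<open>C\<close> depends on \<open>M\<close>; this is
  where \<open>\<delta>\<close> must be small.

  The role of \<open>{\<alpha>..\<beta>}\<close> is to provide \<open>G\<close>.  Comparison of \<open>u\<close> with its chord over \<open>{\<alpha>..\<beta>}\<close> (lemma
  \<open>action_on_subinterval_le\<close>) bounds the action of \<open>u\<close> there by a multiple of \<open>\<beta> - \<alpha>\<close>.  Hence the slope
  is at most \<open>N\<close> on at least half of \<open>{\<alpha>..\<beta>}\<close>, and a set \<open>G\<close> exists as soon as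
  \<open>I \<le> (\<beta> - \<alpha>) / 2\<close>.  For the part of \<open>S\<close> in \<open>{\<alpha>..\<beta>}\<close> the analogous inequality follows from the
  same bound on the action.  For all of \<open>S\<close> it follows by continuity: as the interval grows from
  \<open>{\<alpha>..\<beta>}\<close> to \<open>{a..b}\<close>, the truncation estimate on the intermediate intervals
  keeps the integral of \<open>\<bar>u'\<bar>\<close> over their steep points strictly below \<open>(\<beta> - \<alpha>) / 2\<close>.

  The correction is the primitive of an integrable function; that its derivative is this function
  almost everywhere is Lebesgue's differentiation theorem (\<open>primitive_has_derivative_AE\<close>), obtained
  here from the Vitali covering theorem.
\<close>

section \<open>Lebesgue differentiation on the line\<close>

text \<open>Absolute continuity of the integral: split \<open>f\<close> at a height \<open>k\<close>.  The part above \<open>k\<close> has small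
  integral over the whole space by dominated convergence, and the part below contributes at most
  \<open>k\<close> times the measure of the set.\<close>

lemma integral_small_on_small_sets:
  fixes f :: "'a \<Rightarrow> real"
  assumes f: "integrable M f" and "0 < \<epsilon>"
  obtains \<delta> where "0 < \<delta>"
    "\<And>A. A \<in> fmeasurable M \<Longrightarrow> measure M A < \<delta> \<Longrightarrow> (LINT x:A|M. \<bar>f x\<bar>) < \<epsilon>"
proof -
  define s where "s k x = (if \<bar>f x\<bar> > real k then \<bar>f x\<bar> else 0)" for k x
  have [measurable]: "f \<in> borel_measurable M"
    using f by auto
  have s_meas [measurable]: "s k \<in> borel_measurable M" for k
    unfolding s_def by measurable
  have s_int: "integrable M (s k)" for k
    by (rule Bochner_Integration.integrable_bound[OF f]) (auto simp: s_def)
  have "(\<lambda>k. LINT x|M. s k x) \<longlonglongrightarrow> (LINT x|M. 0)"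
  proof (rule integral_dominated_convergence[where w = "\<lambda>x. \<bar>f x\<bar>"])
    show "AE x in M. (\<lambda>k. s k x) \<longlonglongrightarrow> 0"
    proof (rule AE_I2)
      fix x
      obtain n where "\<bar>f x\<bar> \<le> real n"
        using real_arch_simple by blast
      then have "s k x = 0" if "n \<le> k" for k
        using that by (auto simp: s_def)
      then have "\<forall>\<^sub>F k in sequentially. s k x = 0"
        by (rule eventually_sequentiallyI)
      then show "(\<lambda>k. s k x) \<longlonglongrightarrow> 0"
        by (rule tendsto_eventually)
    qed
  qed (use f in \<open>auto simp: s_def\<close>)
  then have "\<forall>\<^sub>F k in sequentially. (LINT x|M. s k x) < \<epsilon> / 2"
    using \<open>0 < \<epsilon>\<close> by (intro order_tendstoD(2)) auto
  then obtain k where k: "(LINT x|M. s k x) < \<epsilon> / 2"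
    by (auto simp: eventually_sequentially)
  show thesis
  proof
    show "0 < \<epsilon> / (2 * (real k + 1))"
      using \<open>0 < \<epsilon>\<close> by simp
    fix A assume A: "A \<in> fmeasurable M" and small: "measure M A < \<epsilon> / (2 * (real k + 1))"
    have A': "A \<in> sets M" "emeasure M A < \<infinity>"
      using A by (auto simp: fmeasurable_def)
    have ind: "integrable M (\<lambda>x. real k * indicator A x)"
      using A' by (intro integrable_mult_right integrable_real_indicator) auto
    have "(LINT x:A|M. \<bar>f x\<bar>) \<le> (LINT x|M. s k x + real k * indicator A x)"
      unfolding set_lebesgue_integral_def
    proof (rule integral_mono)
      show "integrable M (\<lambda>x. indicator A x *\<^sub>R \<bar>f x\<bar>)"
        using A' f by (intro integrable_mult_indicator) auto
      show "integrable M (\<lambda>x. s k x + real k * indicator A x)"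
        using s_int ind by (rule Bochner_Integration.integrable_add)
    qed (auto simp: s_def indicator_def)
    also have "\<dots> = (LINT x|M. s k x) + real k * measure M A"
      using s_int ind A' by (subst Bochner_Integration.integral_add) auto
    also have "\<dots> < \<epsilon> / 2 + \<epsilon> / 2"
    proof (rule add_less_le_mono[OF k])
      have "real k * measure M A \<le> (real k + 1) * (\<epsilon> / (2 * (real k + 1)))"
        using small by (intro mult_mono) auto
      also have "\<dots> = \<epsilon> / 2"
        by (simp add: field_simps add_eq_0_iff_both_eq_0)
      finally show "real k * measure M A \<le> \<epsilon> / 2" .
    qed
    finally show "(LINT x:A|M. \<bar>f x\<bar>) < \<epsilon>"
      by simp
  qed
qed

lemma set_integral_nonneg_countable_UN:
  fixes f :: "'a \<Rightarrow> real"
  assumes "countable C" and disj: "disjoint_family_on A C"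
    and meas: "\<And>i. i \<in> C \<Longrightarrow> A i \<in> sets M"
    and int: "set_integrable M (\<Union>i\<in>C. A i) f"
    and nonneg: "\<And>i. i \<in> C \<Longrightarrow> 0 \<le> (LINT x:A i|M. f x)"
  shows "0 \<le> (LINT x:(\<Union>i\<in>C. A i)|M. f x)"
proof -
  define D where "D n = {i \<in> C. to_nat_on C i \<le> n}" for n
  define B where "B n = (\<Union>i\<in>D n. A i)" for n
  have fin: "finite (D n)" for n
  proof (rule finite_imageD[of "to_nat_on C"])
    show "finite (to_nat_on C ` D n)"
      by (rule finite_subset[of _ "{..n}"]) (auto simp: D_def)
    show "inj_on (to_nat_on C) (D n)"
      using inj_on_to_nat_on[OF \<open>countable C\<close>] by (rule inj_on_subset) (auto simp: D_def)
  qed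
  have DC: "D n \<subseteq> C" for n
    by (auto simp: D_def)
  have Bmeas: "B n \<in> sets M" for n
    unfolding B_def using fin DC meas by (intro sets.finite_UN) auto
  have UB: "(\<Union>n. B n) = (\<Union>i\<in>C. A i)"
    by (auto simp: B_def D_def)
  have "(\<lambda>n. LINT x:B n|M. f x) \<longlonglongrightarrow> (LINT x:(\<Union>n. B n)|M. f x)"
  proof (rule set_integral_cont_up)
    show "incseq B"
      by (auto simp: incseq_def B_def D_def)
  qed (use Bmeas int UB in auto)
  moreover have "0 \<le> (LINT x:B n|M. f x)" for n
  proof -
    have "(LINT x:B n|M. f x) = (\<Sum>i\<in>D n. LINT x:A i|M. f x)"
      unfolding B_def
    proof (rule set_integral_finite_Union)
      show "disjoint_family_on A (D n)"
        using disj DC by (rule disjoint_family_on_mono[rotated])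
      show "set_integrable M (A i) f" if "i \<in> D n" for i
        using that DC by (intro set_integrable_subset[OF int]) (auto intro: meas)
    qed (use fin DC meas in auto)
    also have "\<dots> \<ge> 0"
      using nonneg DC by (intro sum_nonneg) auto
    finally show ?thesis .
  qed
  ultimately show ?thesis
    unfolding UB[symmetric] by (intro LIMSEQ_le_const) auto
qed

lemma set_integrable_const: "A \<in> lmeasurable \<Longrightarrow> set_integrable lebesgue A (\<lambda>x. q :: real)"
  unfolding set_integrable_def fmeasurable_def by (auto intro!: integrable_real_indicator)

lemma LINT_const: "A \<in> lmeasurable \<Longrightarrow> (LINT x:A|lebesgue. q :: real) = q * measure lebesgue A"
  by (simp add: set_lebesgue_integral_def fmeasurable_def)

definition primitive :: "(real \<Rightarrow> real) \<Rightarrow> real \<Rightarrow> real" where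
  "primitive f x = (LINT t:{..x}|lebesgue. f t)"

lemma integrable_imp_set_integrable:
  fixes f :: "real \<Rightarrow> real"
  assumes "integrable lebesgue f" "A \<in> sets lebesgue"
  shows "set_integrable lebesgue A f"
  using assms unfolding set_integrable_def by (intro integrable_mult_indicator) auto

lemma primitive_diff:
  assumes f: "integrable lebesgue f" and "y \<le> z"
  shows "primitive f z - primitive f y = (LINT t:{y..z}|lebesgue. f t)"
proof -
  have "primitive f z = (LINT t:{..y} \<union> {y..z}|lebesgue. f t)"
    using \<open>y \<le> z\<close> unfolding primitive_def by (intro arg_cong2[where f = "\<lambda>A. set_lebesgue_integral lebesgue A"]) auto
  also have "\<dots> = primitive f y + (LINT t:{y..z}|lebesgue. f t)"
    unfolding primitive_def
  proof (rule set_integral_Un_AE)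
    have "AE x in lebesgue. x \<noteq> y"
      by (rule AE_I'[of "{y}"]) (auto simp: negligible_iff_null_sets[symmetric])
    then show "AE x in lebesgue. \<not> (x \<in> {..y} \<and> x \<in> {y..z})"
      by eventually_elim auto
  qed (auto intro!: integrable_imp_set_integrable f)
  finally show ?thesis by simp
qed

text \<open>The Vitali covering argument.  Each point of the exceptional set has arbitrarily short intervals
  around it on which the mean of \<open>f\<close> exceeds \<open>r\<close>, so countably many disjoint ones of them, inside
  a small open neighbourhood \<open>U\<close> of \<open>W = {f < s}\<close>, cover it up to a null set.  On their union
  \<open>V\<close> the mean of \<open>f\<close> is at least \<open>r\<close>; but \<open>f < s\<close> on \<open>V \<inter> W\<close>, and the rest of \<open>V\<close> lies in
  \<open>U - W\<close>, where the integral of \<open>f\<close> is tiny.  As \<open>s < r\<close>, the measure of \<open>V\<close> is tiny.\<close>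

lemma differentiation_exceptional_set_negligible:
  fixes f :: "real \<Rightarrow> real"
  assumes f: "integrable lebesgue f" and "s < r"
  shows "negligible {x. f x < s \<and> (\<forall>d>0. \<exists>y z. y \<le> x \<and> x \<le> z \<and> y < z \<and> z - y < d \<and>
           primitive f z - primitive f y > r * (z - y))}"
    (is "negligible ?E")
proof -
  have [measurable]: "f \<in> borel_measurable lebesgue"
    using f by auto
  have "negligible (?E \<inter> ball 0 (real n))" for n
  proof (rule negligible_outer_le[THEN iffD2], intro allI impI)
    fix e :: real assume "0 < e"
    \<comment> \<open>The intersection with a ball makes the measure finite.\<close>
    define W where "W = {x. f x < s} \<inter> ball 0 (real n)"
    \<comment> \<open>Chosen to match the final estimate \<open>(r - s) * measure V \<le> (1 + \<bar>s\<bar>) * \<eta>\<close>.\<close>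
    define \<eta> where "\<eta> = e * (r - s) / (1 + \<bar>s\<bar>)"
    have "0 < \<eta>"
      using \<open>0 < e\<close> \<open>s < r\<close> by (simp add: \<eta>_def)
    have "{x \<in> space lebesgue. f x < s} \<in> sets lebesgue"
      by measurable
    then have W: "W \<in> lmeasurable"
      unfolding W_def by (intro fmeasurable_Int_fmeasurable[OF lmeasurable_ball, THEN subst[where P="\<lambda>A. A \<in> lmeasurable", OF Int_commute]]) auto
    obtain \<delta> where "0 < \<delta>" and \<delta>:
      "\<And>A. A \<in> lmeasurable \<Longrightarrow> measure lebesgue A < \<delta> \<Longrightarrow> (LINT x:A|lebesgue. \<bar>f x\<bar>) < \<eta>"
      using integral_small_on_small_sets[OF f \<open>0 < \<eta>\<close>] by blast
    have "0 < min \<delta> \<eta>"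
      using \<open>0 < \<delta>\<close> \<open>0 < \<eta>\<close> by simp
    obtain U where U: "open U" "W \<subseteq> U" "U - W \<in> lmeasurable" "emeasure lebesgue (U - W) < ennreal (min \<delta> \<eta>)"
      using sets_lebesgue_outer_open[OF fmeasurableD[OF W] \<open>0 < min \<delta> \<eta>\<close>] by blast
    have small: "measure lebesgue (U - W) < min \<delta> \<eta>"
      using U(3,4) \<open>0 < min \<delta> \<eta>\<close> by (simp add: emeasure_eq_measure2 ennreal_less_iff del: min_less_iff_conj)
    define K where "K = {(c, \<rho>). 0 < \<rho> \<and> cball c \<rho> \<subseteq> U \<and> primitive f (c + \<rho>) - primitive f (c - \<rho>) > r * (2 * \<rho>)}"
    have fine: "\<exists>i. i \<in> K \<and> x \<in> cball (fst i) (snd i) \<and> snd i < d"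
      if x: "x \<in> ?E \<inter> ball 0 (real n)" and "0 < d" for x d
    proof -
      have "x \<in> U"
        using x U(2) by (auto simp: W_def)
      then obtain k where "0 < k" and k: "ball x k \<subseteq> U"
        using U(1) openE by blast
      have "0 < min d k"
        using \<open>0 < d\<close> \<open>0 < k\<close> by simp
      then obtain y z where yz: "y \<le> x" "x \<le> z" "y < z" "z - y < min d k"
          "primitive f z - primitive f y > r * (z - y)"
        using x by blast
      define c \<rho> where "c = (y + z) / 2" and "\<rho> = (z - y) / 2"
      have ends: "c + \<rho> = z" "c - \<rho> = y" and \<rho>: "2 * \<rho> = z - y"
        by (simp_all add: c_def \<rho>_def add_divide_distrib[symmetric] diff_divide_distrib[symmetric])
      have cball: "cball c \<rho> = {y..z}"
        by (simp add: cball_eq_atLeastAtMost ends)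
      moreover have "{y..z} \<subseteq> ball x k"
        using yz by (auto simp: dist_real_def)
      ultimately have "(c, \<rho>) \<in> K"
        unfolding K_def mem_Collect_eq prod.case ends \<rho> using yz k \<rho> by auto
      moreover have "x \<in> cball c \<rho>" "\<rho> < d"
        unfolding cball using yz \<rho> by auto
      ultimately show "\<exists>i. i \<in> K \<and> x \<in> cball (fst i) (snd i) \<and> snd i < d"
        by (intro exI[of _ "(c, \<rho>)"]) auto
    qed
    have pos: "0 < snd i" if "i \<in> K" for i
      using that by (auto simp: K_def)
    obtain C where "countable C" "C \<subseteq> K"
      and disj: "pairwise (\<lambda>i j. disjnt (cball (fst i) (snd i)) (cball (fst j) (snd j))) C"
      and neg: "negligible (?E \<inter> ball 0 (real n) - (\<Union>i\<in>C. cball (fst i) (snd i)))"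
      by (rule Vitali_covering_theorem_cballs[of K snd "?E \<inter> ball 0 (real n)" fst, OF pos fine])
    define V where "V = (\<Union>i\<in>C. cball (fst i) (snd i))"
    have VU: "V \<subseteq> U"
      unfolding V_def
    proof (rule UN_least)
      fix i assume "i \<in> C"
      then have "i \<in> K"
        using \<open>C \<subseteq> K\<close> by blast
      then show "cball (fst i) (snd i) \<subseteq> U"
        by (simp add: K_def split_def)
    qed
    have Vsets: "V \<in> sets lebesgue"
      unfolding V_def using \<open>countable C\<close> by (intro sets.countable_UN') auto
    have "U \<in> lmeasurable"
      using fmeasurable.Un[OF W U(3)] U(2) by (simp add: Un_absorb1)
    then have V: "V \<in> lmeasurable"
      using VU Vsets by (rule fmeasurableI2)
    have Wsets: "W \<in> sets lebesgue"
      using W by (rule fmeasurableD)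
    have f_int: "set_integrable lebesgue A f" if "A \<in> sets lebesgue" for A
      using f that by (rule integrable_imp_set_integrable)
    have "0 \<le> (LINT x:(\<Union>i\<in>C. cball (fst i) (snd i))|lebesgue. f x - r)"
    proof (rule set_integral_nonneg_countable_UN)
      show "disjoint_family_on (\<lambda>i. cball (fst i) (snd i)) C"
        using disj by (auto simp: disjoint_family_on_def pairwise_def disjnt_def)
      show "set_integrable lebesgue (\<Union>i\<in>C. cball (fst i) (snd i)) (\<lambda>x. f x - r)"
        using V Vsets unfolding V_def[symmetric] by (intro set_integral_diff f_int set_integrable_const)
      fix i assume "i \<in> C"
      then obtain c \<rho> where i: "i = (c, \<rho>)" "0 < \<rho>" "primitive f (c + \<rho>) - primitive f (c - \<rho>) > r * (2 * \<rho>)"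
        using \<open>C \<subseteq> K\<close> by (auto simp: K_def)
      have "(LINT x:{c - \<rho>..c + \<rho>}|lebesgue. f x - r)
          = (LINT x:{c - \<rho>..c + \<rho>}|lebesgue. f x) - (LINT x:{c - \<rho>..c + \<rho>}|lebesgue. r)"
        by (intro set_integral_diff f_int set_integrable_const) auto
      also have "\<dots> = primitive f (c + \<rho>) - primitive f (c - \<rho>) - r * (2 * \<rho>)"
        using \<open>0 < \<rho>\<close> by (subst primitive_diff[OF f]) (auto simp: LINT_const)
      finally show "0 \<le> (LINT x:cball (fst i) (snd i)|lebesgue. f x - r)"
        using i by (simp add: cball_eq_atLeastAtMost)
    qed (use \<open>countable C\<close> in auto)
    then have "0 \<le> (LINT x:V|lebesgue. f x) - (LINT x:V|lebesgue. r)"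
      unfolding V_def[symmetric] using V Vsets by (subst (asm) set_integral_diff(2)) (auto intro: f_int set_integrable_const)
    then have "r * measure lebesgue V \<le> (LINT x:V|lebesgue. f x)"
      using V by (simp add: LINT_const)
    also have "\<dots> = (LINT x:(V \<inter> W) \<union> (V - W)|lebesgue. f x)"
      by (simp add: Int_Diff_Un)
    also have "\<dots> = (LINT x:V \<inter> W|lebesgue. f x) + (LINT x:V - W|lebesgue. f x)"
      using Vsets Wsets by (intro set_integral_Un f_int) auto
    also have "\<dots> \<le> s * measure lebesgue (V \<inter> W) + \<eta>"
    proof (rule add_mono)
      have VW: "V \<inter> W \<in> lmeasurable"
        using V W by (rule fmeasurable.Int)
      have "(LINT x:V \<inter> W|lebesgue. f x) \<le> (LINT x:V \<inter> W|lebesgue. s)"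
        using VW by (intro set_integral_mono f_int set_integrable_const) (auto simp: W_def fmeasurableD)
      then show "(LINT x:V \<inter> W|lebesgue. f x) \<le> s * measure lebesgue (V \<inter> W)"
        using VW by (simp add: LINT_const)
      have VW_small: "V - W \<in> lmeasurable" "measure lebesgue (V - W) \<le> measure lebesgue (U - W)"
        using V W U VU by (auto intro!: measure_mono_fmeasurable fmeasurable_Diff fmeasurableD)
      have "(LINT x:V - W|lebesgue. f x) \<le> (LINT x:V - W|lebesgue. \<bar>f x\<bar>)"
        using Vsets Wsets by (intro set_integral_mono set_integrable_abs f_int) auto
      also have "\<dots> < \<eta>"
        using VW_small small by (intro \<delta>) auto
      finally show "(LINT x:V - W|lebesgue. f x) \<le> \<eta>"
        by simp
    qed
    also have "s * measure lebesgue (V \<inter> W) \<le> s * measure lebesgue V + \<bar>s\<bar> * \<eta>"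
    proof -
      have "measure lebesgue (V - W) \<le> measure lebesgue (U - W)"
        using V W U VU by (auto intro!: measure_mono_fmeasurable fmeasurable_Diff fmeasurableD)
      then have le: "measure lebesgue (V - W) \<le> \<eta>"
        using small by simp
      have eq: "measure lebesgue V = measure lebesgue (V \<inter> W) + measure lebesgue (V - W)"
        using measure_Un3[OF fmeasurable.Int[OF V W] fmeasurable.Diff[OF V W]]
        by (simp add: Int_Diff_Un Int_Diff_disjoint)
      have "- s * measure lebesgue (V - W) \<le> \<bar>s\<bar> * \<eta>"
        using le by (intro mult_mono) auto
      then show ?thesis
        by (simp add: eq algebra_simps)
    qed
    finally have "(r - s) * measure lebesgue V \<le> (1 + \<bar>s\<bar>) * \<eta>"
      by (simp add: algebra_simps)
    also have "\<dots> = (r - s) * e"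
      by (simp add: \<eta>_def field_simps add_eq_0_iff_both_eq_0)
    finally have Ve: "measure lebesgue V \<le> e"
      using \<open>s < r\<close> by simp
    show "\<exists>T. ?E \<inter> ball 0 (real n) \<subseteq> T \<and> T \<in> lmeasurable \<and> measure lebesgue T \<le> e"
    proof (intro exI conjI)
      let ?N = "?E \<inter> ball 0 (real n) - V"
      have N: "negligible ?N"
        using neg by (simp add: V_def)
      show "?E \<inter> ball 0 (real n) \<subseteq> V \<union> ?N"
        by auto
      show "V \<union> ?N \<in> lmeasurable"
        by (rule fmeasurable.Un[OF V negligible_imp_measurable[OF N]])
      show "measure lebesgue (V \<union> ?N) \<le> e"
        using measure_Un_le[OF fmeasurableD[OF V] fmeasurableD[OF negligible_imp_measurable[OF N]]]
          negligible_imp_measure0[OF N] Ve by linarith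
    qed
  qed
  then have "negligible (\<Union>n. ?E \<inter> ball 0 (real n))"
    by (intro negligible_countable_Union) auto
  moreover have "(\<Union>n. ?E \<inter> ball 0 (real n)) = ?E"
    using reals_Archimedean2 by (auto simp: dist_real_def)
  ultimately show ?thesis
    by simp
qed

lemma primitive_uminus: "primitive (\<lambda>x. - f x) x = - primitive f x"
  by (simp add: primitive_def set_lebesgue_integral_def)

text \<open>A point outside the exceptional sets of all pairs of rationals \<open>s < r\<close> satisfies the estimate
  for every real \<open>r\<close> above \<open>f x\<close>.\<close>

lemma primitive_upper_derivative_AE:
  fixes f :: "real \<Rightarrow> real"
  assumes f: "integrable lebesgue f"
  shows "AE x in lebesgue. \<forall>r>f x. \<exists>d>0. \<forall>y z. y \<le> x \<and> x \<le> z \<and> y < z \<and> z - y < d \<longrightarrow>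
           primitive f z - primitive f y \<le> r * (z - y)"
proof -
  define E where "E s r = {x. f x < s \<and> (\<forall>d>0. \<exists>y z. y \<le> x \<and> x \<le> z \<and> y < z \<and> z - y < d \<and>
           primitive f z - primitive f y > r * (z - y))}" for s r
  have "AE x in lebesgue. x \<notin> E s r" if "s < r" for s r
    using differentiation_exceptional_set_negligible[OF f that]
    unfolding E_def[symmetric] negligible_iff_null_sets by (rule AE_not_in)
  then have "AE x in lebesgue. \<forall>s\<in>\<rat>. \<forall>r\<in>\<rat>. s < r \<longrightarrow> x \<notin> E s r"
    by (simp add: AE_ball_countable[OF countable_rat])
  then show ?thesis
  proof eventually_elim
    case (elim x)
    show ?case
    proof (intro allI impI)
      fix r assume "f x < r"
      obtain r' where r': "r' \<in> \<rat>" "f x < r'" "r' < r"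
        using Rats_dense_in_real[OF \<open>f x < r\<close>] by auto
      obtain s where s: "s \<in> \<rat>" "f x < s" "s < r'"
        using Rats_dense_in_real[OF \<open>f x < r'\<close>] by auto
      have "x \<notin> E s r'"
        using elim r' s by auto
      then obtain d where "d > 0" and d: "\<And>y z. y \<le> x \<and> x \<le> z \<and> y < z \<and> z - y < d \<Longrightarrow>
           primitive f z - primitive f y \<le> r' * (z - y)"
        using s by (auto simp: E_def not_less) (metis not_less)
      have "primitive f z - primitive f y \<le> r * (z - y)" if "y \<le> x \<and> x \<le> z \<and> y < z \<and> z - y < d" for y z
        using d[OF that] r'(3) that mult_right_mono[of r' r "z - y"] by linarith
      with \<open>d > 0\<close> show "\<exists>d>0. \<forall>y z. y \<le> x \<and> x \<le> z \<and> y < z \<and> z - y < d \<longrightarrow>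
           primitive f z - primitive f y \<le> r * (z - y)"
        by blast
    qed
  qed
qed

text \<open>Lebesgue's differentiation theorem on the line: the one-sided estimate for \<open>f\<close> bounds the
  difference quotients from above, and the one for \<open>- f\<close> bounds them from below.\<close>

theorem primitive_has_derivative_AE:
  fixes f :: "real \<Rightarrow> real"
  assumes f: "integrable lebesgue f"
  shows "AE x in lebesgue. (primitive f has_real_derivative f x) (at x)"
proof -
  have "integrable lebesgue (\<lambda>x. - f x)"
    using f by simp
  from primitive_upper_derivative_AE[OF f] primitive_upper_derivative_AE[OF this] show ?thesis
  proof eventually_elim
    case (elim x)
    let ?F = "primitive f"
    have "((\<lambda>y. (?F y - ?F x) / (y - x)) \<longlongrightarrow> f x) (at x)"
    proof (rule tendstoI)
      fix e :: real assume "0 < e"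
      obtain d1 where "d1 > 0" and d1: "\<And>y z. y \<le> x \<Longrightarrow> x \<le> z \<Longrightarrow> y < z \<Longrightarrow> z - y < d1 \<Longrightarrow>
          ?F z - ?F y \<le> (f x + e / 2) * (z - y)"
        using elim(1)[rule_format, of "f x + e / 2"] \<open>0 < e\<close> by auto
      obtain d2 where "d2 > 0" and d2: "\<And>y z. y \<le> x \<Longrightarrow> x \<le> z \<Longrightarrow> y < z \<Longrightarrow> z - y < d2 \<Longrightarrow>
          - ?F z + ?F y \<le> (- f x + e / 2) * (z - y)"
        using elim(2)[rule_format, of "- f x + e / 2"] \<open>0 < e\<close> by (auto simp: primitive_uminus)
      have incr: "\<bar>(?F z - ?F y) / (z - y) - f x\<bar> < e"
        if "y \<le> x" "x \<le> z" "y < z" "z - y < d1" "z - y < d2" for y z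
      proof -
        have "0 < z - y" using that by simp
        have "(?F z - ?F y) / (z - y) \<le> f x + e / 2"
          using d1[OF that(1-4)] \<open>0 < z - y\<close> by (simp add: pos_divide_le_eq)
        moreover have "f x - e / 2 \<le> (?F z - ?F y) / (z - y)"
        proof -
          have "(f x - e / 2) * (z - y) = - ((- f x + e / 2) * (z - y))"
            by (simp add: algebra_simps)
          then have "(f x - e / 2) * (z - y) \<le> ?F z - ?F y"
            using d2[OF that(1-3,5)] by linarith
          then show ?thesis
            using \<open>0 < z - y\<close> by (simp only: pos_le_divide_eq)
        qed
        ultimately show ?thesis
          using \<open>0 < e\<close> by linarith
      qed
      show "\<forall>\<^sub>F y in at x. dist ((?F y - ?F x) / (y - x)) (f x) < e"
        unfolding eventually_at
      proof (intro exI[of _ "min d1 d2"] conjI ballI impI)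
        fix y assume y: "y \<noteq> x \<and> dist y x < min d1 d2"
        show "dist ((?F y - ?F x) / (y - x)) (f x) < e"
        proof (cases "x < y")
          case True
          then show ?thesis
            using incr[of x y] y by (auto simp: dist_real_def)
        next
          case False
          then have "(?F y - ?F x) / (y - x) = (?F x - ?F y) / (x - y)"
            using minus_divide_divide[of "?F x - ?F y" "x - y"] by simp
          then show ?thesis
            using incr[of y x] y False by (auto simp: dist_real_def)
        qed
      qed (use \<open>d1 > 0\<close> \<open>d2 > 0\<close> in auto)
    qed
    then show ?case
      by (simp add: has_field_derivative_iff)
  qed
qed

lemma primitive_increment_le:
  assumes f: "integrable lebesgue f" and "y \<le> z"
  shows "\<bar>primitive f z - primitive f y\<bar> \<le> (LINT t:{y<..<z}|lebesgue. \<bar>f t\<bar>)"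
proof -
  have int: "set_integrable lebesgue A f" if "A \<in> sets lebesgue" for A
    using f that by (rule integrable_imp_set_integrable)
  have "primitive f z - primitive f y = (LINT t:{y..z}|lebesgue. f t)"
    using assms by (rule primitive_diff)
  also have "\<dots> = (LINT t:{y<..<z}|lebesgue. f t)"
  proof (rule set_integral_cong_set)
    have "AE x in lebesgue. x \<notin> {y, z}"
      by (rule AE_not_in) (simp add: negligible_iff_null_sets[symmetric])
    then show "AE x in lebesgue. (x \<in> {y<..<z}) = (x \<in> {y..z})"
      by eventually_elim auto
  qed (use int[of "{y..z}"] int[of "{y<..<z}"] in \<open>auto simp: set_borel_measurable_def set_integrable_def\<close>)
  also have "\<bar>\<dots>\<bar> \<le> (LINT t:{y<..<z}|lebesgue. \<bar>f t\<bar>)"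
    using integral_norm_bound[of lebesgue "\<lambda>x. indicator {y<..<z} x *\<^sub>R f x"]
    by (simp add: set_lebesgue_integral_def abs_mult)
  finally show ?thesis .
qed

section \<open>Absolutely continuous functions\<close>

text \<open>\<open>\<delta>\<close> witnesses the condition of absolute continuity for \<open>\<epsilon>\<close>; separating the quantifiers over
  interval families from those over \<open>\<epsilon>\<close> and \<open>\<delta>\<close> keeps the closure proofs short.\<close>

definition AC_modulus :: "(real \<Rightarrow> real) \<Rightarrow> real \<Rightarrow> real \<Rightarrow> real \<Rightarrow> real \<Rightarrow> bool" where
  "AC_modulus u a b \<epsilon> \<delta> \<longleftrightarrow> (\<forall>(I :: nat set) c d.
     finite I \<and> (\<forall>i\<in>I. a \<le> c i \<and> c i \<le> d i \<and> d i \<le> b) \<and>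
     disjoint_family_on (\<lambda>i. {c i<..<d i}) I \<and> (\<Sum>i\<in>I. d i - c i) < \<delta> \<longrightarrow>
     (\<Sum>i\<in>I. \<bar>u (d i) - u (c i)\<bar>) < \<epsilon>)"

lemma AC_iff_modulus: "u \<in> AC a b \<longleftrightarrow> (\<forall>\<epsilon>>0. \<exists>\<delta>>0. AC_modulus u a b \<epsilon> \<delta>)"
  by (simp add: AC_def AC_modulus_def)

lemma AC_I: "(\<And>\<epsilon>. 0 < \<epsilon> \<Longrightarrow> \<exists>\<delta>>0. AC_modulus u a b \<epsilon> \<delta>) \<Longrightarrow> u \<in> AC a b"
  by (simp add: AC_iff_modulus)

lemma AC_E:
  assumes "u \<in> AC a b" "0 < \<epsilon>"
  obtains \<delta> where "0 < \<delta>" "AC_modulus u a b \<epsilon> \<delta>"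
  using assms unfolding AC_iff_modulus by blast

lemma AC_modulusI:
  assumes "\<And>(I :: nat set) c d. finite I \<Longrightarrow> (\<And>i. i \<in> I \<Longrightarrow> a \<le> c i \<and> c i \<le> d i \<and> d i \<le> b) \<Longrightarrow>
     disjoint_family_on (\<lambda>i. {c i<..<d i}) I \<Longrightarrow> (\<Sum>i\<in>I. d i - c i) < \<delta> \<Longrightarrow>
     (\<Sum>i\<in>I. \<bar>u (d i) - u (c i)\<bar>) < \<epsilon>"
  shows "AC_modulus u a b \<epsilon> \<delta>"
  unfolding AC_modulus_def by (intro allI impI, elim conjE, rule assms) blast+

lemma AC_modulusD:
  fixes I :: "nat set"
  assumes "AC_modulus u a b \<epsilon> \<delta>" "finite I" "\<And>i. i \<in> I \<Longrightarrow> a \<le> c i \<and> c i \<le> d i \<and> d i \<le> b"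
     "disjoint_family_on (\<lambda>i. {c i<..<d i}) I" "(\<Sum>i\<in>I. d i - c i) < \<delta>"
  shows "(\<Sum>i\<in>I. \<bar>u (d i) - u (c i)\<bar>) < \<epsilon>"
  using assms(1)[unfolded AC_modulus_def, rule_format, of I c d] assms(2-) by blast

lemma AC_primitive:
  assumes f: "integrable lebesgue f"
  shows "primitive f \<in> AC a b"
proof (rule AC_I)
  fix \<epsilon> :: real assume "0 < \<epsilon>"
  obtain \<delta> where "0 < \<delta>" and \<delta>:
    "\<And>A. A \<in> lmeasurable \<Longrightarrow> measure lebesgue A < \<delta> \<Longrightarrow> (LINT x:A|lebesgue. \<bar>f x\<bar>) < \<epsilon>"
    using integral_small_on_small_sets[OF f \<open>0 < \<epsilon>\<close>] by blast
  have "AC_modulus (primitive f) a b \<epsilon> \<delta>"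
  proof (rule AC_modulusI)
    fix I :: "nat set" and c d
    assume "finite I" and I: "\<And>i. i \<in> I \<Longrightarrow> a \<le> c i \<and> c i \<le> d i \<and> d i \<le> b"
      and disj: "disjoint_family_on (\<lambda>i. {c i<..<d i}) I" and less: "(\<Sum>i\<in>I. d i - c i) < \<delta>"
    have cd: "c i \<le> d i" if "i \<in> I" for i
      using I[OF that] by blast
    have "(\<Sum>i\<in>I. \<bar>primitive f (d i) - primitive f (c i)\<bar>) \<le> (\<Sum>i\<in>I. LINT t:{c i<..<d i}|lebesgue. \<bar>f t\<bar>)"
      by (intro sum_mono primitive_increment_le f cd)
    also have "\<dots> = (LINT t:(\<Union>i\<in>I. {c i<..<d i})|lebesgue. \<bar>f t\<bar>)"
      using \<open>finite I\<close> disj f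
      by (intro set_integral_finite_Union[symmetric] set_integrable_abs integrable_imp_set_integrable) auto
    also have "\<dots> < \<epsilon>"
    proof (rule \<delta>)
      have "measure lebesgue (\<Union>i\<in>I. {c i<..<d i}) \<le> (\<Sum>i\<in>I. measure lebesgue {c i<..<d i})"
        using \<open>finite I\<close> by (intro measure_UNION_le) auto
      also have "\<dots> = (\<Sum>i\<in>I. d i - c i)"
        by (intro sum.cong) (auto simp: cd)
      finally show "measure lebesgue (\<Union>i\<in>I. {c i<..<d i}) < \<delta>"
        using less by simp
    qed (use \<open>finite I\<close> in \<open>auto intro!: fmeasurable.finite_UN\<close>)
    finally show "(\<Sum>i\<in>I. \<bar>primitive f (d i) - primitive f (c i)\<bar>) < \<epsilon>" .
  qed
  with \<open>0 < \<delta>\<close> show "\<exists>\<delta>>0. AC_modulus (primitive f) a b \<epsilon> \<delta>"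
    by blast
qed

lemma AC_cong:
  assumes "u \<in> AC a b" "\<And>x. x \<in> {a..b} \<Longrightarrow> u x = v x"
  shows "v \<in> AC a b"
proof (rule AC_I)
  fix \<epsilon> :: real assume "0 < \<epsilon>"
  obtain \<delta> where "0 < \<delta>" and \<delta>: "AC_modulus u a b \<epsilon> \<delta>"
    using assms(1) \<open>0 < \<epsilon>\<close> by (rule AC_E)
  have "AC_modulus v a b \<epsilon> \<delta>"
  proof (rule AC_modulusI)
    fix I :: "nat set" and c d
    assume I: "finite I" "\<And>i. i \<in> I \<Longrightarrow> a \<le> c i \<and> c i \<le> d i \<and> d i \<le> b"
      "disjoint_family_on (\<lambda>i. {c i<..<d i}) I" "(\<Sum>i\<in>I. d i - c i) < \<delta>"
    have "v (c i) = u (c i)" "v (d i) = u (d i)" if "i \<in> I" for i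
      using I(2)[OF that] assms(2) by auto
    then show "(\<Sum>i\<in>I. \<bar>v (d i) - v (c i)\<bar>) < \<epsilon>"
      using AC_modulusD[OF \<delta> I] by simp
  qed
  with \<open>0 < \<delta>\<close> show "\<exists>\<delta>>0. AC_modulus v a b \<epsilon> \<delta>"
    by blast
qed

lemma AC_add:
  assumes "u \<in> AC a b" "v \<in> AC a b"
  shows "(\<lambda>x. u x + v x) \<in> AC a b"
proof (rule AC_I)
  fix \<epsilon> :: real assume "0 < \<epsilon>"
  then have "0 < \<epsilon> / 2" by simp
  obtain \<delta>1 where "0 < \<delta>1" and \<delta>1: "AC_modulus u a b (\<epsilon> / 2) \<delta>1"
    using assms(1) \<open>0 < \<epsilon> / 2\<close> by (rule AC_E)
  obtain \<delta>2 where "0 < \<delta>2" and \<delta>2: "AC_modulus v a b (\<epsilon> / 2) \<delta>2"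
    using assms(2) \<open>0 < \<epsilon> / 2\<close> by (rule AC_E)
  have "AC_modulus (\<lambda>x. u x + v x) a b \<epsilon> (min \<delta>1 \<delta>2)"
  proof (rule AC_modulusI)
    fix I :: "nat set" and c d
    assume I: "finite I" "\<And>i. i \<in> I \<Longrightarrow> a \<le> c i \<and> c i \<le> d i \<and> d i \<le> b"
      "disjoint_family_on (\<lambda>i. {c i<..<d i}) I" "(\<Sum>i\<in>I. d i - c i) < min \<delta>1 \<delta>2"
    have less: "(\<Sum>i\<in>I. d i - c i) < \<delta>1" "(\<Sum>i\<in>I. d i - c i) < \<delta>2"
      using I(4) by auto
    have "(\<Sum>i\<in>I. \<bar>u (d i) + v (d i) - (u (c i) + v (c i))\<bar>)
        \<le> (\<Sum>i\<in>I. \<bar>u (d i) - u (c i)\<bar> + \<bar>v (d i) - v (c i)\<bar>)"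
      by (intro sum_mono) auto
    also have "\<dots> < \<epsilon> / 2 + \<epsilon> / 2"
      unfolding sum.distrib
      by (intro add_strict_mono AC_modulusD[OF \<delta>1 I(1-3) less(1)] AC_modulusD[OF \<delta>2 I(1-3) less(2)])
    finally show "(\<Sum>i\<in>I. \<bar>u (d i) + v (d i) - (u (c i) + v (c i))\<bar>) < \<epsilon>"
      by simp
  qed
  moreover have "0 < min \<delta>1 \<delta>2"
    using \<open>0 < \<delta>1\<close> \<open>0 < \<delta>2\<close> by simp
  ultimately show "\<exists>\<delta>>0. AC_modulus (\<lambda>x. u x + v x) a b \<epsilon> \<delta>"
    by blast
qed

lemma AC_affine: "(\<lambda>x. k * x + q) \<in> AC a b"
proof (rule AC_I)
  fix \<epsilon> :: real assume "0 < \<epsilon>"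
  have "AC_modulus (\<lambda>x. k * x + q) a b \<epsilon> (\<epsilon> / (\<bar>k\<bar> + 1))"
  proof (rule AC_modulusI)
    fix I :: "nat set" and c d
    assume I: "\<And>i. i \<in> I \<Longrightarrow> a \<le> c i \<and> c i \<le> d i \<and> d i \<le> b" "(\<Sum>i\<in>I. d i - c i) < \<epsilon> / (\<bar>k\<bar> + 1)"
    have "(\<Sum>i\<in>I. \<bar>k * d i + q - (k * c i + q)\<bar>) = (\<Sum>i\<in>I. \<bar>k\<bar> * (d i - c i))"
    proof (rule sum.cong)
      fix i assume "i \<in> I"
      have "k * d i + q - (k * c i + q) = k * (d i - c i)"
        by (simp add: algebra_simps)
      then show "\<bar>k * d i + q - (k * c i + q)\<bar> = \<bar>k\<bar> * (d i - c i)"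
        using I(1)[OF \<open>i \<in> I\<close>] by (simp add: abs_mult)
    qed simp
    also have "\<dots> = \<bar>k\<bar> * (\<Sum>i\<in>I. d i - c i)"
      by (simp add: sum_distrib_left)
    also have "\<dots> \<le> (\<bar>k\<bar> + 1) * (\<Sum>i\<in>I. d i - c i)"
      using I(1) by (intro mult_right_mono sum_nonneg) auto
    also have "\<dots> < \<epsilon>"
      using I(2) by (simp add: pos_less_divide_eq mult.commute)
    finally show "(\<Sum>i\<in>I. \<bar>k * d i + q - (k * c i + q)\<bar>) < \<epsilon>" .
  qed
  then show "\<exists>\<delta>>0. AC_modulus (\<lambda>x. k * x + q) a b \<epsilon> \<delta>"
    using \<open>0 < \<epsilon>\<close> by (intro exI[of _ "\<epsilon> / (\<bar>k\<bar> + 1)"]) auto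
qed

text \<open>A monotone map that does not stretch distances carries non-overlapping families of intervals to
  such families of no greater total length.  With the maps \<open>min \<alpha>\<close>, \<open>max \<beta>\<close> and the clamp to
  \<open>{\<alpha>..\<beta>}\<close> this makes gluing of absolutely continuous functions a matter of adding three
  compositions.\<close>

lemma AC_compose_mono:
  assumes u: "u \<in> AC a b"
    and into: "\<And>x. x \<in> {a..b} \<Longrightarrow> \<phi> x \<in> {a..b}"
    and \<phi>: "\<And>x y. x \<le> y \<Longrightarrow> \<phi> x \<le> \<phi> y" "\<And>x y. x \<le> y \<Longrightarrow> \<phi> y - \<phi> x \<le> y - x"
  shows "(\<lambda>x. u (\<phi> x)) \<in> AC a b"
proof (rule AC_I)
  fix \<epsilon> :: real assume "0 < \<epsilon>"
  obtain \<delta> where "0 < \<delta>" and \<delta>: "AC_modulus u a b \<epsilon> \<delta>"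
    using u \<open>0 < \<epsilon>\<close> by (rule AC_E)
  have "AC_modulus (\<lambda>x. u (\<phi> x)) a b \<epsilon> \<delta>"
  proof (rule AC_modulusI)
    fix I :: "nat set" and c d
    assume I: "finite I" "\<And>i. i \<in> I \<Longrightarrow> a \<le> c i \<and> c i \<le> d i \<and> d i \<le> b"
      "disjoint_family_on (\<lambda>i. {c i<..<d i}) I" "(\<Sum>i\<in>I. d i - c i) < \<delta>"
    show "(\<Sum>i\<in>I. \<bar>u (\<phi> (d i)) - u (\<phi> (c i))\<bar>) < \<epsilon>"
    proof (rule AC_modulusD[OF \<delta> I(1)])
      have \<phi>_less: "x < y" if "\<phi> x < \<phi> y" for x y
        using \<phi>(1)[of y x] that by linarith
      show "disjoint_family_on (\<lambda>i. {\<phi> (c i)<..<\<phi> (d i)}) I"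
        unfolding disjoint_family_on_def
      proof (intro ballI impI)
        fix i j assume ij: "i \<in> I" "j \<in> I" "i \<noteq> j"
        have "False" if t: "t \<in> {\<phi> (c i)<..<\<phi> (d i)}" "t \<in> {\<phi> (c j)<..<\<phi> (d j)}" for t
        proof -
          have "c i < d i" "c j < d j" "c i < d j" "c j < d i"
            by (rule \<phi>_less, use t in simp)+
          then have "max (c i) (c j) < min (d i) (d j)"
            by simp
          then obtain y where "max (c i) (c j) < y" "y < min (d i) (d j)"
            using dense by blast
          then have "y \<in> {c i<..<d i} \<inter> {c j<..<d j}"
            by auto
          moreover have "{c i<..<d i} \<inter> {c j<..<d j} = {}"
            using I(3) ij unfolding disjoint_family_on_def by blast
          ultimately show False
            by blast
        qed
        then show "{\<phi> (c i)<..<\<phi> (d i)} \<inter> {\<phi> (c j)<..<\<phi> (d j)} = {}"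
          by blast
      qed
      have "(\<Sum>i\<in>I. \<phi> (d i) - \<phi> (c i)) \<le> (\<Sum>i\<in>I. d i - c i)"
        using I(2) by (intro sum_mono \<phi>(2)) auto
      then show "(\<Sum>i\<in>I. \<phi> (d i) - \<phi> (c i)) < \<delta>"
        using I(4) by linarith
      show "a \<le> \<phi> (c i) \<and> \<phi> (c i) \<le> \<phi> (d i) \<and> \<phi> (d i) \<le> b" if "i \<in> I" for i
      proof -
        have cd: "a \<le> c i" "c i \<le> d i" "d i \<le> b"
          using I(2)[OF that] by auto
        then have "c i \<in> {a..b}" "d i \<in> {a..b}"
          by auto
        then show ?thesis
          using into[of "c i"] into[of "d i"] \<phi>(1)[OF cd(2)] by simp
      qed
    qed
  qed
  with \<open>0 < \<delta>\<close> show "\<exists>\<delta>>0. AC_modulus (\<lambda>x. u (\<phi> x)) a b \<epsilon> \<delta>"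
    by blast
qed

lemma AC_imp_continuous_on:
  assumes u: "u \<in> AC a b"
  shows "continuous_on {a..b} u"
  unfolding continuous_on_iff
proof (intro ballI allI impI)
  fix x \<epsilon> :: real assume "x \<in> {a..b}" "0 < \<epsilon>"
  obtain \<delta> where "0 < \<delta>" and \<delta>: "AC_modulus u a b \<epsilon> \<delta>"
    using u \<open>0 < \<epsilon>\<close> by (rule AC_E)
  have "dist (u y) (u x) < \<epsilon>" if "y \<in> {a..b}" "dist y x < \<delta>" for y
  proof -
    have "\<bar>u (max x y) - u (min x y)\<bar> < \<epsilon>"
      using AC_modulusD[OF \<delta>, of "{0}" "\<lambda>_. min x y" "\<lambda>_. max x y"] that \<open>x \<in> {a..b}\<close>
      by (auto simp: disjoint_family_on_def dist_real_def)
    then show ?thesis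
      by (auto simp: dist_real_def min_def max_def abs_minus_commute split: if_splits)
  qed
  then show "\<exists>d>0. \<forall>x'\<in>{a..b}. dist x' x < d \<longrightarrow> dist (u x') (u x) < \<epsilon>"
    using \<open>0 < \<delta>\<close> by blast
qed

section \<open>Measurability of the derivative\<close>

text \<open>\<^const>\<open>deriv\<close> chooses some number satisfying an unsatisfiable predicate at a point of
  non-differentiability, hence the same number for all functions and points.\<close>

lemma deriv_default:
  obtains j where "\<And>f x. \<not> f field_differentiable (at x) \<Longrightarrow> deriv f x = (j :: 'a :: real_normed_field)"
proof
  fix f :: "'a \<Rightarrow> 'a" and x assume "\<not> f field_differentiable (at x)"
  then have "(\<lambda>D. (f has_field_derivative D) (at x)) = (\<lambda>D. False)"
    by (auto simp: field_differentiable_def)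
  then show "deriv f x = (SOME D. False)"
    by (simp add: deriv_def)
qed

lemma continuous_le_of_le_on_rationals:
  fixes g :: "real \<Rightarrow> real"
  assumes "isCont g x" "open U" "x \<in> U" and le: "\<And>p. p \<in> U \<Longrightarrow> p \<in> \<rat> \<Longrightarrow> g p \<le> c"
  shows "g x \<le> c"
proof (rule ccontr)
  assume "\<not> g x \<le> c"
  then have "\<forall>\<^sub>F y in nhds x. c < g y"
    using assms(1) by (intro order_tendstoD(1)[of g "g x"]) (auto simp: isCont_def tendsto_at_iff_tendsto_nhds)
  moreover have "\<forall>\<^sub>F y in nhds x. y \<in> U"
    using assms by (intro eventually_nhds_in_open) auto
  ultimately have "\<forall>\<^sub>F y in nhds x. c < g y \<and> y \<in> U"
    by eventually_elim auto
  then obtain e where "e > 0" and e: "\<And>y. dist y x < e \<Longrightarrow> c < g y \<and> y \<in> U"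
    unfolding eventually_nhds_metric by blast
  obtain p where "p \<in> \<rat>" "x < p" "p < x + e"
    using Rats_dense_in_real[of x "x + e"] \<open>e > 0\<close> by auto
  then show False
    using e[of p] le[of p] by (auto simp: dist_real_def)
qed

text \<open>The Cauchy criterion for difference quotients.  By continuity of \<open>u\<close> it suffices to test rational
  increments, which turns differentiability into a countable combination of measurable conditions.\<close>

lemma field_differentiable_iff_rational_Cauchy:
  fixes u :: "real \<Rightarrow> real"
  assumes u: "continuous_on UNIV u"
  defines "Q \<equiv> \<lambda>h x. (u (x + h) - u x) / h"
  shows "u field_differentiable (at x) \<longleftrightarrow>
    (\<forall>n::nat. \<exists>k::nat. \<forall>p q::rat. 0 < \<bar>real_of_rat p\<bar> \<and> \<bar>real_of_rat p\<bar> < 1 / Suc k \<and>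
        0 < \<bar>real_of_rat q\<bar> \<and> \<bar>real_of_rat q\<bar> < 1 / Suc k \<longrightarrow>
       \<bar>Q (real_of_rat p) x - Q (real_of_rat q) x\<bar> \<le> 1 / Suc n)"
    (is "?diff \<longleftrightarrow> _")
proof -
  define C where "C n k \<longleftrightarrow> (\<forall>p q::rat. 0 < \<bar>real_of_rat p\<bar> \<and> \<bar>real_of_rat p\<bar> < 1 / Suc k \<and>
        0 < \<bar>real_of_rat q\<bar> \<and> \<bar>real_of_rat q\<bar> < 1 / Suc k \<longrightarrow>
       \<bar>Q (real_of_rat p) x - Q (real_of_rat q) x\<bar> \<le> 1 / Suc n)" for n k :: nat
  have "?diff \<longleftrightarrow> (\<forall>n. \<exists>k. C n k)"
  proof
    assume ?diff
    then obtain D where "(u has_field_derivative D) (at x)"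
      by (auto simp: field_differentiable_def)
    then have lim: "((\<lambda>h. Q h x) \<longlongrightarrow> D) (at 0)"
      by (simp add: DERIV_def Q_def)
    show "\<forall>n. \<exists>k. C n k"
    proof
      fix n
      have "\<forall>\<^sub>F h in at 0. dist (Q h x) D < 1 / Suc n / 2"
        by (intro tendstoD[OF lim]) simp
      then obtain d where "d > 0" and d: "\<And>h. h \<noteq> 0 \<Longrightarrow> \<bar>h\<bar> < d \<Longrightarrow> \<bar>Q h x - D\<bar> < 1 / Suc n / 2"
        by (auto simp: eventually_at dist_real_def)
      obtain k where "1 / Suc k < d"
        using \<open>d > 0\<close> nat_approx_posE by blast
      have "C n k"
        unfolding C_def
      proof (intro allI impI, elim conjE)
        fix p q :: rat
        let ?p = "real_of_rat p" and ?q = "real_of_rat q"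
        assume "0 < \<bar>?p\<bar>" "\<bar>?p\<bar> < 1 / Suc k" "0 < \<bar>?q\<bar>" "\<bar>?q\<bar> < 1 / Suc k"
        then have "\<bar>Q ?p x - D\<bar> < 1 / Suc n / 2" "\<bar>Q ?q x - D\<bar> < 1 / Suc n / 2"
          using d[of ?p] d[of ?q] \<open>1 / Suc k < d\<close> by linarith+
        moreover have "\<bar>y - z\<bar> \<le> e" if "\<bar>y - D\<bar> < e / 2" "\<bar>z - D\<bar> < e / 2" for y z e
          using that by linarith
        ultimately show "\<bar>Q ?p x - Q ?q x\<bar> \<le> 1 / Suc n"
          by blast
      qed
      then show "\<exists>k. C n k" ..
    qed
  next
    assume cauchy: "\<forall>n. \<exists>k. C n k"
    have cont: "isCont (\<lambda>h. \<bar>Q h x - y\<bar>) h" if "h \<noteq> 0" for h y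
    proof -
      have "continuous_on UNIV (\<lambda>h. u (x + h))"
        by (intro continuous_on_compose2[OF u] continuous_intros) auto
      then have "isCont (\<lambda>h. u (x + h)) h"
        by (simp add: continuous_on_eq_continuous_at)
      then show ?thesis
        unfolding Q_def using that by (intro continuous_intros) auto
    qed
    have close: "\<exists>\<delta>>0. \<forall>h h'. 0 < \<bar>h\<bar> \<longrightarrow> \<bar>h\<bar> < \<delta> \<longrightarrow> 0 < \<bar>h'\<bar> \<longrightarrow> \<bar>h'\<bar> < \<delta> \<longrightarrow> \<bar>Q h x - Q h' x\<bar> < e" if "e > 0" for e
    proof -
      obtain n where n: "1 / Suc n < e"
        using \<open>e > 0\<close> nat_approx_posE by blast
      obtain k where k: "C n k"
        using cauchy by blast
      define U where "U = {h. 0 < \<bar>h\<bar> \<and> \<bar>h\<bar> < 1 / Suc k}"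
      have "open U"
        unfolding U_def by (intro open_Collect_conj open_Collect_less continuous_intros)
      have rational: "\<bar>Q h x - Q q x\<bar> \<le> 1 / Suc n" if "h \<in> U" "q \<in> U" "q \<in> \<rat>" for h q
      proof (rule continuous_le_of_le_on_rationals[OF cont \<open>open U\<close> \<open>h \<in> U\<close>])
        show "h \<noteq> 0"
          using that by (auto simp: U_def)
      qed (use that k in \<open>auto simp: U_def C_def elim!: Rats_cases\<close>)
      have real: "\<bar>Q h' x - Q h x\<bar> \<le> 1 / Suc n" if "h \<in> U" "h' \<in> U" for h h'
      proof (rule continuous_le_of_le_on_rationals[OF cont \<open>open U\<close> \<open>h' \<in> U\<close>])
        show "h' \<noteq> 0"
          using that by (auto simp: U_def)
      next
        fix p assume "p \<in> U" "p \<in> \<rat>"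
        then show "\<bar>Q p x - Q h x\<bar> \<le> 1 / Suc n"
          using rational[OF \<open>h \<in> U\<close>, of p] by (simp add: abs_minus_commute)
      qed
      have "\<bar>Q h x - Q h' x\<bar> < e" if "h \<in> U" "h' \<in> U" for h h'
        using real[OF that(2,1)] n by linarith
      moreover have "0 < 1 / real (Suc k)"
        by simp
      ultimately show ?thesis
        unfolding U_def mem_Collect_eq by blast
    qed
    have "Cauchy (\<lambda>m. Q (1 / Suc m) x)"
    proof (rule metric_CauchyI)
      fix e :: real assume "e > 0"
      then obtain \<delta> where "\<delta> > 0" and *: "\<forall>h h'. 0 < \<bar>h\<bar> \<longrightarrow> \<bar>h\<bar> < \<delta> \<longrightarrow> 0 < \<bar>h'\<bar> \<longrightarrow> \<bar>h'\<bar> < \<delta> \<longrightarrow> \<bar>Q h x - Q h' x\<bar> < e"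
        using close by blast
      note \<delta> = *[rule_format]
      obtain k where k: "1 / Suc k < \<delta>"
        using \<open>\<delta> > 0\<close> nat_approx_posE by blast
      have "1 / real (Suc m) < \<delta>" if "m \<ge> k" for m
        using that k by (intro le_less_trans[OF _ k]) (auto simp: field_simps)
      then show "\<exists>M. \<forall>m\<ge>M. \<forall>n\<ge>M. dist (Q (1 / Suc m) x) (Q (1 / Suc n) x) < e"
        unfolding dist_real_def by (intro exI[of _ k] allI impI \<delta>) auto
    qed
    then obtain D where D: "(\<lambda>m. Q (1 / Suc m) x) \<longlonglongrightarrow> D"
      using Cauchy_convergent_iff convergent_def by blast
    have "((\<lambda>h. Q h x) \<longlongrightarrow> D) (at 0)"
    proof (rule tendstoI)
      fix e :: real assume "e > 0"
      then have "0 < e / 2"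
        by simp
      then obtain \<delta> where "\<delta> > 0" and *: "\<forall>h h'. 0 < \<bar>h\<bar> \<longrightarrow> \<bar>h\<bar> < \<delta> \<longrightarrow> 0 < \<bar>h'\<bar> \<longrightarrow> \<bar>h'\<bar> < \<delta> \<longrightarrow> \<bar>Q h x - Q h' x\<bar> < e / 2"
        using close by blast
      note \<delta> = *[rule_format]
      have "\<bar>Q h x - D\<bar> < e" if h: "h \<noteq> 0" "\<bar>h\<bar> < \<delta>" for h
      proof -
        have "(\<lambda>m. \<bar>Q h x - Q (1 / Suc m) x\<bar>) \<longlonglongrightarrow> \<bar>Q h x - D\<bar>"
          by (intro tendsto_intros D)
        moreover have "\<exists>M. \<forall>m\<ge>M. \<bar>Q h x - Q (1 / Suc m) x\<bar> \<le> e / 2"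
        proof -
          obtain k where k: "1 / Suc k < \<delta>"
            using \<open>\<delta> > 0\<close> nat_approx_posE by blast
          have "1 / real (Suc m) < \<delta>" if "m \<ge> k" for m
            using that k by (intro le_less_trans[OF _ k]) (auto simp: field_simps)
          then show ?thesis
            using h by (intro exI[of _ k] allI impI less_imp_le \<delta>) auto
        qed
        ultimately have "\<bar>Q h x - D\<bar> \<le> e / 2"
          by (intro LIMSEQ_le_const2) auto
        then show ?thesis
          using \<open>e > 0\<close> by linarith
      qed
      then show "\<forall>\<^sub>F h in at 0. dist (Q h x) D < e"
        using \<open>\<delta> > 0\<close> by (auto simp: eventually_at dist_real_def)
    qed
    then show ?diff
      by (auto simp: field_differentiable_def DERIV_def Q_def)
  qed
  then show ?thesis
    unfolding C_def .
qed

text \<open>Where \<open>u\<close> is differentiable, \<^term>\<open>deriv u\<close> is a limit of a sequence of continuous difference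
  quotients; elsewhere it is constant.\<close>

lemma borel_measurable_deriv:
  fixes u :: "real \<Rightarrow> real"
  assumes u: "continuous_on UNIV u"
  shows "deriv u \<in> borel_measurable borel"
proof -
  obtain j where j: "\<And>f x. \<not> f field_differentiable (at x) \<Longrightarrow> deriv f x = (j :: real)"
    using deriv_default[where 'a = real] by blast
  define Q where "Q h x = (u (x + h) - u x) / h" for h x
  have [measurable]: "u \<in> borel_measurable borel"
    using u by (rule borel_measurable_continuous_onI)
  have [measurable]: "Measurable.pred borel (\<lambda>x. u field_differentiable (at x))"
    unfolding field_differentiable_iff_rational_Cauchy[OF u] by measurable
  have "deriv u = (\<lambda>x. if u field_differentiable (at x) then lim (\<lambda>m. Q (1 / Suc m) x) else j)"
  proof
    fix x
    show "deriv u x = (if u field_differentiable (at x) then lim (\<lambda>m. Q (1 / Suc m) x) else j)"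
    proof (cases "u field_differentiable (at x)")
      case True
      then have "((\<lambda>h. Q h x) \<longlongrightarrow> deriv u x) (at 0)"
        by (simp add: field_differentiable_derivI[unfolded DERIV_def] Q_def)
      moreover have "filterlim (\<lambda>m. 1 / real (Suc m)) (at 0) sequentially"
        using LIMSEQ_Suc[OF lim_1_over_n] by (auto simp: filterlim_at simp del: of_nat_Suc)
      ultimately have "(\<lambda>m. Q (1 / Suc m) x) \<longlonglongrightarrow> deriv u x"
        by (rule filterlim_compose)
      then show ?thesis
        using True by (simp add: limI)
    qed (simp add: j)
  qed
  also have "\<dots> \<in> borel_measurable borel"
    unfolding Q_def by measurable
  finally show ?thesis .
qed

section \<open>Integrals, Lagrangians and competitors\<close>

lemma ext_integral_eq_LINT:
  assumes "set_integrable lebesgue S f"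
  shows "ext_integral S f = ereal (LINT x:S|lebesgue. f x)"
proof -
  define g where "g x = indicator S x *\<^sub>R f x" for x
  have g: "integrable lebesgue g"
    using assms by (simp add: set_integrable_def g_def[abs_def])
  have pos: "(\<integral>\<^sup>+x\<in>S. ennreal (f x) \<partial>lebesgue) = (\<integral>\<^sup>+x. ennreal (g x) \<partial>lebesgue)"
    and neg: "(\<integral>\<^sup>+x\<in>S. ennreal (- f x) \<partial>lebesgue) = (\<integral>\<^sup>+x. ennreal (- g x) \<partial>lebesgue)"
    by (auto intro!: nn_integral_cong simp: g_def indicator_def)
  have fin: "(\<integral>\<^sup>+x. ennreal (g x) \<partial>lebesgue) \<noteq> \<infinity>" "(\<integral>\<^sup>+x. ennreal (- g x) \<partial>lebesgue) \<noteq> \<infinity>"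
    using g by (simp_all add: real_integrable_def)
  have enn2ereal: "enn2ereal A = ereal (enn2real A)" if "A \<noteq> \<infinity>" for A
    using that by (cases A) (auto simp: enn2ereal_ennreal)
  have "(LINT x:S|lebesgue. f x) = integral\<^sup>L lebesgue g"
    by (simp add: set_lebesgue_integral_def g_def[abs_def])
  then show ?thesis
    unfolding ext_integral_def pos neg
    using fin by (simp add: enn2ereal real_lebesgue_integral_def[OF g])
qed

lemma set_integrable_of_ext_integral:
  assumes S: "S \<in> lmeasurable" and f: "f \<in> borel_measurable lebesgue"
    and lower: "\<And>x. x \<in> S \<Longrightarrow> - m \<le> f x" and fin: "ext_integral S f \<noteq> \<infinity>"
  shows "set_integrable lebesgue S f"
proof -
  define g where "g x = indicator S x *\<^sub>R f x" for x
  have S': "S \<in> sets lebesgue" "emeasure lebesgue S < \<infinity>"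
    using S by (auto simp: fmeasurable_def)
  have pos: "(\<integral>\<^sup>+x\<in>S. ennreal (f x) \<partial>lebesgue) = (\<integral>\<^sup>+x. ennreal (g x) \<partial>lebesgue)"
    and neg: "(\<integral>\<^sup>+x\<in>S. ennreal (- f x) \<partial>lebesgue) = (\<integral>\<^sup>+x. ennreal (- g x) \<partial>lebesgue)"
    by (auto intro!: nn_integral_cong simp: g_def indicator_def)
  have "(\<integral>\<^sup>+x. ennreal (- g x) \<partial>lebesgue) \<le> (\<integral>\<^sup>+x. ennreal m * indicator S x \<partial>lebesgue)"
    using lower by (intro nn_integral_mono) (auto simp: g_def indicator_def minus_le_iff intro!: ennreal_leI)
  also have "\<dots> = ennreal m * emeasure lebesgue S"
    using S' by (simp add: nn_integral_cmult_indicator)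
  also have "\<dots> < \<infinity>"
    using S' by (simp add: ennreal_mult_less_top)
  finally have neg_fin: "(\<integral>\<^sup>+x. ennreal (- g x) \<partial>lebesgue) \<noteq> \<infinity>"
    by simp
  then obtain r where "(\<integral>\<^sup>+x. ennreal (- g x) \<partial>lebesgue) = ennreal r" "0 \<le> r"
    by (cases "\<integral>\<^sup>+x. ennreal (- g x) \<partial>lebesgue") auto
  then have pos_fin: "(\<integral>\<^sup>+x. ennreal (g x) \<partial>lebesgue) \<noteq> \<infinity>"
    using fin unfolding ext_integral_def pos neg by (auto simp: enn2ereal_ennreal)
  have "g \<in> borel_measurable lebesgue"
    unfolding g_def using S' f by measurable
  then show ?thesis
    using neg_fin pos_fin unfolding set_integrable_def g_def[symmetric] by (simp add: real_integrable_def)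
qed

lemma ext_integral_cong_AE:
  assumes "AE x in lebesgue. (x \<in> S \<longleftrightarrow> x \<in> T) \<and> (x \<in> S \<longrightarrow> f x = g x)"
  shows "ext_integral S f = ext_integral T g"
proof -
  have "(\<integral>\<^sup>+x\<in>S. ennreal (f x) \<partial>lebesgue) = (\<integral>\<^sup>+x\<in>T. ennreal (g x) \<partial>lebesgue)"
    "(\<integral>\<^sup>+x\<in>S. ennreal (- f x) \<partial>lebesgue) = (\<integral>\<^sup>+x\<in>T. ennreal (- g x) \<partial>lebesgue)"
    using assms by (auto intro!: nn_integral_cong_AE simp: indicator_def)
  then show ?thesis
    by (simp add: ext_integral_def)
qed

text \<open>Local upper bounds become uniform on a compact box.\<close>

lemma lagrangian_bounded_on_boxes:
  assumes "lagrangian L"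
  obtains B where "0 \<le> B"
    "\<And>x y p. \<bar>x\<bar> \<le> N \<Longrightarrow> \<bar>y\<bar> \<le> N \<Longrightarrow> \<bar>p\<bar> \<le> N \<Longrightarrow> L (x, y, p) \<le> B"
proof -
  have "\<exists>B U. open U \<and> z \<in> U \<and> (\<forall>w\<in>U. L w \<le> B)" for z
    using assms unfolding lagrangian_def eventually_nhds by blast
  then obtain b U where U: "\<And>z. open (U z)" "\<And>z. z \<in> U z" "\<And>z w. w \<in> U z \<Longrightarrow> L w \<le> b z"
    by metis
  define Box where "Box = {-N..N} \<times> {-N..N} \<times> {-N..N}"
  have "compact Box"
    unfolding Box_def by (intro compact_Times compact_Icc)
  moreover have "Box \<subseteq> (\<Union>z\<in>Box. U z)"
    using U(2) by blast
  ultimately obtain F where F: "F \<subseteq> Box" "finite F" "Box \<subseteq> (\<Union>z\<in>F. U z)"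
    using U(1) by (meson compactE_image)
  show thesis
  proof
    show "0 \<le> (\<Sum>z\<in>F. \<bar>b z\<bar>)"
      by (intro sum_nonneg) auto
    fix x y p :: real assume "\<bar>x\<bar> \<le> N" "\<bar>y\<bar> \<le> N" "\<bar>p\<bar> \<le> N"
    then have "(x, y, p) \<in> Box"
      by (auto simp: Box_def abs_le_iff)
    then obtain z where z: "z \<in> F" "(x, y, p) \<in> U z"
      using F(3) by blast
    have "L (x, y, p) \<le> \<bar>b z\<bar>"
      using U(3)[OF z(2)] by linarith
    also have "\<dots> \<le> (\<Sum>z\<in>F. \<bar>b z\<bar>)"
      using F(2) z(1) by (intro member_le_sum) auto
    finally show "L (x, y, p) \<le> (\<Sum>z\<in>F. \<bar>b z\<bar>)" .
  qed
qed

lemma lagrangian_growth: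
  assumes "lagrangian L"
  obtains P where "1 \<le> P" "\<And>x y p. P \<le> \<bar>p\<bar> \<Longrightarrow> K * \<bar>p\<bar> \<le> L (x, y, p)"
proof -
  obtain \<omega> where \<omega>: "superlinear \<omega>" "\<And>x y p. \<omega> p \<le> L (x, y, p)"
    using assms unfolding lagrangian_def by blast
  have "\<forall>\<^sub>F p in at_infinity. K \<le> \<omega> p / \<bar>p\<bar>"
    using \<omega>(1) unfolding superlinear_def filterlim_at_top by blast
  then obtain b where b: "\<And>p. b \<le> \<bar>p\<bar> \<Longrightarrow> K \<le> \<omega> p / \<bar>p\<bar>"
    by (auto simp: eventually_at_infinity)
  show thesis
  proof
    show "1 \<le> max b 1"
      by simp
    fix x y p :: real assume p: "max b 1 \<le> \<bar>p\<bar>"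
    then have "K * \<bar>p\<bar> \<le> \<omega> p"
      using b[of p] by (auto simp: pos_le_divide_eq)
    then show "K * \<bar>p\<bar> \<le> L (x, y, p)"
      using \<omega>(2)[of p x y] by linarith
  qed
qed

lemma lagrangian_lower_bound:
  assumes "lagrangian L"
  obtains m where "0 \<le> m" "\<And>z. - m \<le> L z"
proof -
  obtain k where k: "\<And>z. k \<le> L z"
    using assms by (auto simp: lagrangian_def)
  have "- \<bar>k\<bar> \<le> L z" for z
    using k[of z] by linarith
  then show thesis
    using that[of "\<bar>k\<bar>"] by simp
qed

lemma borel_measurable_lebesgue_deriv:
  fixes u :: "real \<Rightarrow> real"
  assumes u: "continuous_on UNIV u"
  shows "deriv u \<in> borel_measurable lebesgue"
  using borel_measurable_deriv[OF u] by (intro measurable_completion) simp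

lemma sets_large_deriv:
  fixes u :: "real \<Rightarrow> real"
  assumes "continuous_on UNIV u"
  shows "{x \<in> {c..d}. M < \<bar>deriv u x\<bar>} \<in> sets lebesgue"
proof -
  have [measurable]: "deriv u \<in> borel_measurable lebesgue"
    using assms by (rule borel_measurable_lebesgue_deriv)
  have "{x \<in> space lebesgue. M < \<bar>deriv u x\<bar>} \<in> sets lebesgue"
    by measurable
  then have "{c..d} \<inter> {x. M < \<bar>deriv u x\<bar>} \<in> sets lebesgue"
    by (intro sets.Int) auto
  then show ?thesis
    by (simp add: Int_def)
qed

lemma borel_measurable_integrand:
  fixes u :: "real \<Rightarrow> real"
  assumes L: "lagrangian L" and u: "continuous_on UNIV u"
  shows "(\<lambda>x. L (x, u x, deriv u x)) \<in> borel_measurable lebesgue"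
proof -
  have [measurable]: "L \<in> borel_measurable borel" "u \<in> borel_measurable borel" "deriv u \<in> borel_measurable borel"
    using L borel_measurable_continuous_onI[OF u] borel_measurable_deriv[OF u] by (auto simp: lagrangian_def)
  have "(\<lambda>x. (x, u x, deriv u x)) \<in> borel \<rightarrow>\<^sub>M borel"
    by (intro borel_measurable_Pair) measurable
  then have "(\<lambda>x. L (x, u x, deriv u x)) \<in> borel_measurable borel"
    by measurable
  then show ?thesis
    by (intro measurable_completion) simp
qed

lemma set_integrable_integrand:
  assumes L: "lagrangian L" and u: "continuous_on UNIV u" and fin: "action L u a b \<noteq> \<infinity>"
  shows "set_integrable lebesgue {a..b} (\<lambda>x. L (x, u x, deriv u x))"
proof -
  obtain m where m: "\<And>z. - m \<le> L z"
    using lagrangian_lower_bound[OF L] by blast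
  show ?thesis
    using fin m borel_measurable_integrand[OF L u]
    by (intro set_integrable_of_ext_integral[where m = m]) (auto simp: action_def)
qed

text \<open>How every competitor is used: if replacing \<open>u\<close> by \<open>w\<close> raises the integrand by at most \<open>g\<close>, then
  the minimal action lies below that of \<open>u\<close> by at least \<open>- \<integral> g\<close>.\<close>

lemma excess_lower_bound:
  assumes L: "lagrangian L"
    and int_u: "set_integrable lebesgue {a..b} (\<lambda>x. L (x, u x, deriv u x))"
    and w: "w \<in> AC a b" "continuous_on UNIV w" "w a = u a" "w b = u b"
    and g: "set_integrable lebesgue {a..b} g"
    and le: "AE x in lebesgue. x \<in> {a..b} \<longrightarrow> L (x, w x, deriv w x) \<le> L (x, u x, deriv u x) + g x"
  shows "ereal (- (LINT x:{a..b}|lebesgue. g x)) \<le> excess L u a b"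
proof -
  let ?lu = "\<lambda>x. L (x, u x, deriv u x)" and ?lw = "\<lambda>x. L (x, w x, deriv w x)"
  obtain m where m: "0 \<le> m" "\<And>z. - m \<le> L z"
    using lagrangian_lower_bound[OF L] by blast
  have const: "set_integrable lebesgue {a..b} (\<lambda>x. m)"
    by (rule set_integrable_const) simp
  have int_sum: "set_integrable lebesgue {a..b} (\<lambda>x. ?lu x + g x)"
    using int_u g by (rule set_integral_add)
  have bound: "set_integrable lebesgue {a..b} (\<lambda>x. \<bar>?lu x + g x\<bar> + m)"
    by (rule set_integral_add(1)[OF set_integrable_abs[OF int_sum] const])
  have int_w: "set_integrable lebesgue {a..b} ?lw"
    unfolding set_integrable_def
  proof (rule Bochner_Integration.integrable_bound)
    show "integrable lebesgue (\<lambda>x. indicator {a..b} x *\<^sub>R (\<bar>?lu x + g x\<bar> + m))"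
      using bound by (simp add: set_integrable_def)
    show "(\<lambda>x. indicat_real {a..b} x *\<^sub>R ?lw x) \<in> borel_measurable lebesgue"
      by (intro borel_measurable_scaleR borel_measurable_indicator borel_measurable_integrand[OF L w(2)]) simp
    show "AE x in lebesgue. norm (indicat_real {a..b} x *\<^sub>R ?lw x) \<le> norm (indicat_real {a..b} x *\<^sub>R (\<bar>?lu x + g x\<bar> + m))"
      using le
    proof eventually_elim
      case (elim x)
      have "\<bar>?lw x\<bar> \<le> \<bar>?lu x + g x\<bar> + m" if "x \<in> {a..b}"
        using elim that m(1) m(2)[of "(x, w x, deriv w x)"] by linarith
      then show ?case
        using m(1) by (auto simp: indicator_def)
    qed
  qed
  have "(LINT x:{a..b}|lebesgue. ?lw x) \<le> (LINT x:{a..b}|lebesgue. ?lu x + g x)"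
    using le by (intro set_integral_mono_AE int_w int_sum) auto
  also have "\<dots> = (LINT x:{a..b}|lebesgue. ?lu x) + (LINT x:{a..b}|lebesgue. g x)"
    using int_u g by (rule set_integral_add)
  finally have *: "- (LINT x:{a..b}|lebesgue. g x) \<le> (LINT x:{a..b}|lebesgue. ?lu x) - (LINT x:{a..b}|lebesgue. ?lw x)"
    by linarith
  have "min_action L a (u a) b (u b) \<le> action L w a b"
    unfolding min_action_def using w by (intro INF_lower) auto
  then have "min_action L a (u a) b (u b) \<le> ereal (LINT x:{a..b}|lebesgue. ?lw x)"
    by (simp add: action_def ext_integral_eq_LINT[OF int_w])
  then have "ereal (LINT x:{a..b}|lebesgue. ?lu x) - ereal (LINT x:{a..b}|lebesgue. ?lw x)
      \<le> excess L u a b"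
    unfolding excess_def action_def ext_integral_eq_LINT[OF int_u] by (intro ereal_minus_mono) auto
  moreover have "ereal (- (LINT x:{a..b}|lebesgue. g x))
      \<le> ereal (LINT x:{a..b}|lebesgue. ?lu x) - ereal (LINT x:{a..b}|lebesgue. ?lw x)"
    using * by simp
  ultimately show ?thesis
    by (rule order_trans[rotated])
qed

text \<open>Only values on \<open>{a..b}\<close> enter the action, up to the null set of end points, where \<^term>\<open>deriv u\<close>
  depends on values of \<open>u\<close> outside.  Extending \<open>u\<close> by constants therefore changes nothing and makes
  \<^term>\<open>deriv u\<close> Borel measurable on the whole line.\<close>

lemma AC_continuous_extension:
  assumes u: "u \<in> AC a b" and "a \<le> b"
  obtains w where "w \<in> AC a b" "continuous_on UNIV w" "\<And>x. x \<in> {a..b} \<Longrightarrow> w x = u x"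
    "\<And>x. x \<in> {a<..<b} \<Longrightarrow> deriv w x = deriv u x"
proof
  let ?w = "\<lambda>x. u (max a (min b x))"
  show eq: "?w x = u x" if "x \<in> {a..b}" for x
    using that by simp
  show "?w \<in> AC a b"
    using u by (rule AC_cong) (simp add: eq)
  show "continuous_on UNIV ?w"
    using \<open>a \<le> b\<close> by (intro continuous_on_compose2[OF AC_imp_continuous_on[OF u]] continuous_intros) auto
  show "deriv ?w x = deriv u x" if "x \<in> {a<..<b}" for x
  proof (rule deriv_cong_ev)
    have "\<forall>\<^sub>F y in nhds x. y \<in> {a<..<b}"
      using that by (intro eventually_nhds_in_open) auto
    then show "\<forall>\<^sub>F y in nhds x. ?w y = u y"
      by eventually_elim auto
  qed simp
qed

lemma AE_lebesgue_neq: "AE x in lebesgue. x \<noteq> (y :: real)"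
  using AE_not_in[of "{y}" lebesgue] by (simp add: negligible_iff_null_sets[symmetric])

lemma excess_eq_of_eq_on:
  assumes "\<And>x. x \<in> {a..b} \<Longrightarrow> w x = u x" "\<And>x. x \<in> {a<..<b} \<Longrightarrow> deriv w x = deriv u x" "a \<le> b"
  shows "excess L w a b = excess L u a b"
    and "ext_integral {x \<in> {a..b}. \<bar>deriv w x\<bar> > M} (\<lambda>x. L (x, w x, deriv w x))
       = ext_integral {x \<in> {a..b}. \<bar>deriv u x\<bar> > M} (\<lambda>x. L (x, u x, deriv u x))"
proof -
  have ae: "AE x in lebesgue. x \<in> {a..b} \<longrightarrow> w x = u x \<and> deriv w x = deriv u x"
    using AE_lebesgue_neq[of a] AE_lebesgue_neq[of b] by eventually_elim (use assms in auto)
  have "action L w a b = action L u a b"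
    unfolding action_def using ae by (intro ext_integral_cong_AE) (auto elim: eventually_mono)
  then show "excess L w a b = excess L u a b"
    using assms by (simp add: excess_def)
  show "ext_integral {x \<in> {a..b}. \<bar>deriv w x\<bar> > M} (\<lambda>x. L (x, w x, deriv w x))
       = ext_integral {x \<in> {a..b}. \<bar>deriv u x\<bar> > M} (\<lambda>x. L (x, u x, deriv u x))"
    using ae by (intro ext_integral_cong_AE) (auto elim: eventually_mono)
qed

lemma isCont_primitive:
  assumes "integrable lebesgue f"
  shows "isCont (primitive f) x"
  using AC_imp_continuous_on[OF AC_primitive[OF assms, of "x - 1" "x + 1"]]
  by (rule continuous_on_interior) simp

text \<open>Cut \<open>A\<close> at a suitable point \<open>t\<close>: the measure of \<open>A \<inter> {\<alpha>..t}\<close> depends continuously on \<open>t\<close>.\<close>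

lemma subset_of_given_measure:
  fixes A :: "real set"
  assumes A: "A \<in> lmeasurable" "A \<subseteq> {\<alpha>..\<beta>}" and q: "0 \<le> q" "q \<le> measure lebesgue A" and "\<alpha> \<le> \<beta>"
  obtains G where "G \<in> lmeasurable" "G \<subseteq> A" "measure lebesgue G = q"
proof -
  have f: "integrable lebesgue (indicat_real A)"
    using A by (intro integrable_real_indicator) (auto simp: fmeasurable_def)
  have eq: "primitive (indicat_real A) t - primitive (indicat_real A) \<alpha> = measure lebesgue (A \<inter> {\<alpha>..t})" if "\<alpha> \<le> t" for t
  proof -
    have "indicat_real {\<alpha>..t} x * indicat_real A x = indicator (A \<inter> {\<alpha>..t}) x" for x
      by (auto simp: indicator_def)
    then show ?thesis
      unfolding primitive_diff[OF f that] by (simp add: set_lebesgue_integral_def)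
  qed
  define \<phi> where "\<phi> t = primitive (indicat_real A) t - primitive (indicat_real A) \<alpha>" for t
  have "\<exists>t\<ge>\<alpha>. t \<le> \<beta> \<and> \<phi> t = q"
  proof (rule IVT)
    show "\<phi> \<alpha> \<le> q"
      using q by (simp add: \<phi>_def)
    show "q \<le> \<phi> \<beta>"
      using q A \<open>\<alpha> \<le> \<beta>\<close> by (simp add: \<phi>_def eq Int_absorb2)
    show "\<forall>t. \<alpha> \<le> t \<and> t \<le> \<beta> \<longrightarrow> isCont \<phi> t"
      unfolding \<phi>_def by (intro allI impI continuous_intros isCont_primitive f)
  qed fact
  then obtain t where t: "\<alpha> \<le> t" "t \<le> \<beta>" "\<phi> t = q"
    by blast
  show thesis
  proof
    show "A \<inter> {\<alpha>..t} \<in> lmeasurable"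
      using A by (intro fmeasurable.Int) auto
    show "measure lebesgue (A \<inter> {\<alpha>..t}) = q"
      using t eq[of t] by (simp add: \<phi>_def)
  qed simp
qed

section \<open>The chord and the truncation\<close>

lemma LINT_lower_bound_on_subset:
  fixes f :: "real \<Rightarrow> real"
  assumes f: "set_integrable lebesgue T f" and lower: "\<And>x. x \<in> T \<Longrightarrow> - m \<le> f x" and "0 \<le> m"
    and T: "T \<in> lmeasurable" and A: "A \<in> sets lebesgue" "A \<subseteq> T"
  shows "(LINT x:A|lebesgue. f x) \<le> (LINT x:T|lebesgue. f x) + m * measure lebesgue T"
proof -
  have fA: "set_integrable lebesgue A f"
    using f A by (rule set_integrable_subset)
  have sum: "set_integrable lebesgue T (\<lambda>x. f x + m)"
    by (rule set_integral_add(1)[OF f set_integrable_const[OF T]])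
  have "(LINT x:A|lebesgue. f x) \<le> (LINT x:T|lebesgue. f x + m)"
    unfolding set_lebesgue_integral_def
  proof (rule integral_mono)
    show "integrable lebesgue (\<lambda>x. indicat_real A x *\<^sub>R f x)"
      "integrable lebesgue (\<lambda>x. indicat_real T x *\<^sub>R (f x + m))"
      using fA sum by (simp_all add: set_integrable_def)
    show "indicat_real A x *\<^sub>R f x \<le> indicat_real T x *\<^sub>R (f x + m)" for x
      using A(2) \<open>0 \<le> m\<close> lower[of x] by (auto simp: indicator_def)
  qed
  also have "\<dots> = (LINT x:T|lebesgue. f x) + m * measure lebesgue T"
    by (subst set_integral_add(2)[OF f set_integrable_const[OF T]]) (simp add: LINT_const[OF T])
  finally show ?thesis .
qed

text \<open>The competitor follows the chord of \<open>u\<close> over \<open>{\<alpha>..\<beta>}\<close> and agrees with \<open>u\<close> elsewhere.  The chord has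
  slope at most \<open>R\<close>, so its integrand is at most \<open>B\<close>.\<close>

lemma action_on_subinterval_le:
  assumes L: "lagrangian L"
    and u: "u \<in> AC a b" "continuous_on UNIV u"
    and int_u: "set_integrable lebesgue {a..b} (\<lambda>x. L (x, u x, deriv u x))"
    and \<alpha>\<beta>: "a \<le> \<alpha>" "\<alpha> < \<beta>" "\<beta> \<le> b"
    and range: "- R \<le> \<alpha>" "\<beta> \<le> R" "\<bar>u \<alpha>\<bar> \<le> R" "\<bar>u \<beta>\<bar> \<le> R" "\<bar>u \<beta> - u \<alpha>\<bar> \<le> R * (\<beta> - \<alpha>)"
    and B: "\<And>x y p. \<bar>x\<bar> \<le> R \<Longrightarrow> \<bar>y\<bar> \<le> R \<Longrightarrow> \<bar>p\<bar> \<le> R \<Longrightarrow> L (x, y, p) \<le> B"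
  shows "ereal ((LINT x:{\<alpha>..\<beta>}|lebesgue. L (x, u x, deriv u x)) - B * (\<beta> - \<alpha>)) \<le> excess L u a b"
proof -
  let ?lu = "\<lambda>x. L (x, u x, deriv u x)"
  define s where "s = (u \<beta> - u \<alpha>) / (\<beta> - \<alpha>)"
  have s_mult: "s * (\<beta> - \<alpha>) = u \<beta> - u \<alpha>"
    using \<alpha>\<beta> by (simp add: s_def)
  have s_le: "\<bar>s\<bar> \<le> R"
    using \<alpha>\<beta> range(5) by (simp add: s_def pos_divide_le_eq)
  \<comment> \<open>\<open>u\<close> up to \<open>\<alpha>\<close>, then the chord, then \<open>u\<close>, as a sum of three terms; \<open>0 * x\<close> fits the last constant
    to the pattern of affine functions.\<close>
  define w where "w x = u (min x \<alpha>) + (s * max \<alpha> (min x \<beta>) + (- s * \<alpha>)) + (u (max x \<beta>) + (0 * x + - u \<beta>))" for x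
  have w_left: "w x = u x" if "x \<le> \<alpha>" for x
    using that \<alpha>\<beta> by (simp add: w_def min_def max_def)
  have w_right: "w x = u x" if "\<beta> \<le> x" for x
    using that \<alpha>\<beta> s_mult by (simp add: w_def min_def max_def algebra_simps)
  have w_mid: "w x = u \<alpha> + s * (x - \<alpha>)" if "\<alpha> \<le> x" "x \<le> \<beta>" for x
    using that \<alpha>\<beta> by (simp add: w_def min_def max_def algebra_simps)
  have w_AC: "w \<in> AC a b"
  proof -
    have left: "(\<lambda>x. u (min x \<alpha>)) \<in> AC a b"
      by (rule AC_compose_mono[OF u(1)]) (use \<alpha>\<beta> in auto)
    have right: "(\<lambda>x. u (max x \<beta>)) \<in> AC a b"
      by (rule AC_compose_mono[OF u(1)]) (use \<alpha>\<beta> in auto)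
    have mid: "(\<lambda>x. s * max \<alpha> (min x \<beta>) + - s * \<alpha>) \<in> AC a b"
      by (rule AC_compose_mono[OF AC_affine]) (use \<alpha>\<beta> in auto)
    show ?thesis
      unfolding w_def by (rule AC_add[OF AC_add[OF left mid] AC_add[OF right AC_affine]])
  qed
  have w_cont: "continuous_on UNIV w"
    unfolding w_def by (intro continuous_intros continuous_on_compose2[OF u(2)]) auto
  have deriv_outside: "deriv w x = deriv u x" if "x < \<alpha> \<or> \<beta> < x" for x
  proof (rule deriv_cong_ev)
    have "\<forall>\<^sub>F y in nhds x. y \<in> - {\<alpha>..\<beta>}"
      using that by (intro eventually_nhds_in_open) auto
    then show "\<forall>\<^sub>F y in nhds x. w y = u y"
      by eventually_elim (use w_left w_right in force)
  qed simp
  have deriv_mid: "deriv w x = s" if "\<alpha> < x" "x < \<beta>" for x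
  proof -
    have "\<forall>\<^sub>F y in nhds x. y \<in> {\<alpha><..<\<beta>}"
      using that by (intro eventually_nhds_in_open) auto
    then have "\<forall>\<^sub>F y in nhds x. w y = u \<alpha> + s * (y - \<alpha>)"
      by eventually_elim (simp add: w_mid)
    then have "deriv w x = deriv (\<lambda>y. u \<alpha> + s * (y - \<alpha>)) x"
      by (rule deriv_cong_ev) simp
    also have "\<dots> = s"
      by (rule DERIV_imp_deriv) (auto intro!: derivative_eq_intros)
    finally show ?thesis .
  qed
  have mid_range: "\<bar>w x\<bar> \<le> R" if x: "\<alpha> \<le> x" "x \<le> \<beta>" for x
  proof -
    define t where "t = (x - \<alpha>) / (\<beta> - \<alpha>)"
    have t: "0 \<le> t" "t \<le> 1"
      using x \<alpha>\<beta> by (auto simp: t_def)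
    have "s * (x - \<alpha>) = t * (u \<beta> - u \<alpha>)"
      by (simp add: s_def t_def)
    then have "w x = (1 - t) * u \<alpha> + t * u \<beta>"
      unfolding w_mid[OF x] by (simp add: algebra_simps)
    moreover have "\<bar>(1 - t) * u \<alpha>\<bar> \<le> (1 - t) * R" "\<bar>t * u \<beta>\<bar> \<le> t * R"
      using t range by (auto simp: abs_mult intro!: mult_left_mono)
    ultimately have "\<bar>w x\<bar> \<le> (1 - t) * R + t * R"
      by linarith
    then show ?thesis
      by (simp add: algebra_simps)
  qed
  define g where "g x = indicat_real {\<alpha>..\<beta>} x * (B - ?lu x)" for x
  have int_mid: "set_integrable lebesgue {\<alpha>..\<beta>} ?lu"
    using int_u by (rule set_integrable_subset) (use \<alpha>\<beta> in auto)
  have int_diff: "set_integrable lebesgue {\<alpha>..\<beta>} (\<lambda>x. B - ?lu x)"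
    using set_integrable_const int_mid by (rule set_integral_diff) simp
  have ind: "indicat_real {a..b} x *\<^sub>R g x = indicat_real {\<alpha>..\<beta>} x *\<^sub>R (B - ?lu x)" for x
    using \<alpha>\<beta> by (auto simp: g_def indicator_def)
  have int_g: "set_integrable lebesgue {a..b} g"
    using int_diff by (simp only: set_integrable_def ind)
  have "(LINT x:{a..b}|lebesgue. g x) = (LINT x:{\<alpha>..\<beta>}|lebesgue. B - ?lu x)"
    by (simp only: set_lebesgue_integral_def ind)
  also have "\<dots> = B * (\<beta> - \<alpha>) - (LINT x:{\<alpha>..\<beta>}|lebesgue. ?lu x)"
    using \<alpha>\<beta> by (subst set_integral_diff(2)[OF set_integrable_const int_mid]) (auto simp: LINT_const)
  finally have LINT_g: "(LINT x:{a..b}|lebesgue. g x) = B * (\<beta> - \<alpha>) - (LINT x:{\<alpha>..\<beta>}|lebesgue. ?lu x)" .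
  have "ereal (- (LINT x:{a..b}|lebesgue. g x)) \<le> excess L u a b"
  proof (rule excess_lower_bound[OF L int_u w_AC w_cont _ _ int_g])
    show "w a = u a" "w b = u b"
      using w_left w_right \<alpha>\<beta> by auto
    show "AE x in lebesgue. x \<in> {a..b} \<longrightarrow> L (x, w x, deriv w x) \<le> ?lu x + g x"
      using AE_lebesgue_neq[of \<alpha>] AE_lebesgue_neq[of \<beta>]
    proof eventually_elim
      case (elim x)
      show ?case
      proof (cases "\<alpha> < x \<and> x < \<beta>")
        case True
        then have "L (x, w x, deriv w x) \<le> B"
          using range by (intro B) (auto simp: deriv_mid s_le intro!: mid_range)
        then show ?thesis
          using True by (simp add: g_def)
      next
        case False
        then have out: "x < \<alpha> \<or> \<beta> < x"
          using elim by auto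
        then have "w x = u x"
          using w_left w_right by force
        then show ?thesis
          using out deriv_outside[OF out] by (auto simp: g_def)
      qed
    qed
  qed
  then show ?thesis
    by (simp add: LINT_g)
qed

lemma deriv_add_differentiable:
  fixes u H :: "real \<Rightarrow> real"
  assumes H: "(H has_real_derivative h) (at x)" and u: "u field_differentiable (at x)"
  shows "deriv (\<lambda>x. u x + H x) x = deriv u x + h"
  using DERIV_add[OF field_differentiable_derivI[OF u] H] by (rule DERIV_imp_deriv)

lemma deriv_add_nondifferentiable:
  fixes u H :: "real \<Rightarrow> real"
  assumes H: "(H has_real_derivative h) (at x)" and u: "\<not> u field_differentiable (at x)"
  shows "deriv (\<lambda>x. u x + H x) x = deriv u x"
proof -
  obtain j where j: "\<And>f x. \<not> f field_differentiable (at x) \<Longrightarrow> deriv f x = (j :: real)"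
    using deriv_default[where 'a = real] by blast
  have "\<not> (\<lambda>x. u x + H x) field_differentiable (at x)"
  proof
    assume "(\<lambda>x. u x + H x) field_differentiable (at x)"
    then have "(\<lambda>x. u x + H x - H x) field_differentiable (at x)"
      using H by (intro field_differentiable_diff) (auto simp: field_differentiable_def)
    then show False
      using u by simp
  qed
  then show ?thesis
    using u by (simp add: j)
qed

text \<open>The competitor \<open>w = u + H\<close> has slope \<open>0\<close> on the set \<open>S\<close> of steep points in \<open>{c..d}\<close>.  The increment
  \<open>J = \<integral>\<^sub>S u'\<close> lost in this way is restored by changing the slope by \<open>\<plusminus>1\<close> on a set \<open>G\<close> of measure
  \<open>\<bar>J\<bar>\<close> where \<open>u\<close> has slope at most \<open>N\<close>, so that \<open>w = u\<close> outside \<open>{c..d}\<close> and \<open>\<bar>w - u\<bar> \<le> 2 * I\<close>.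

  The action falls by \<open>\<integral>\<^sub>S L(x, u, u')\<close> and rises by three terms, each a multiple of \<open>I\<close>: the new
  integrand on \<open>S\<close> is at most \<open>B\<close>, the change on \<open>G\<close> is at most \<open>B + m\<close>, and at the other points of
  \<open>{c..d}\<close> the slope is unchanged and at most \<open>M\<close>, so the Lipschitz condition in the second argument
  gives \<open>2 * C * I\<close>.  Only the last term involves a constant that depends on \<open>M\<close>, and it carries the
  factor \<open>b - a\<close>.

  At a point where \<open>u\<close> is not differentiable, \<^term>\<open>deriv u\<close> and \<^term>\<open>deriv w\<close> share the default
  value.  The bound \<open>N\<close> on it keeps such points out of \<open>S\<close>, and the estimates on \<open>G\<close> and on the
  remaining points hold for them as well.\<close>

lemma truncation_competitor:
  assumes L: "lagrangian L" and m: "0 \<le> m" "\<And>z. - m \<le> L z"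
    and default: "0 \<le> N" "\<And>f x. \<not> f field_differentiable (at x) \<Longrightarrow> \<bar>deriv f x :: real\<bar> \<le> N"
    and u: "u \<in> AC a b" "continuous_on UNIV u" "\<And>x. x \<in> {a..b} \<Longrightarrow> \<bar>u x\<bar> \<le> R"
    and int_u: "set_integrable lebesgue {a..b} (\<lambda>x. L (x, u x, deriv u x))"
    and cd: "a \<le> c" "c \<le> d" "d \<le> b" and range: "{a..b} \<subseteq> {-R..R}"
    and M: "1 \<le> M" "N \<le> M" "\<And>x y p. M < \<bar>p\<bar> \<Longrightarrow> \<bar>p\<bar> \<le> L (x, y, p)"
    and B: "0 \<le> B" "\<And>x y p. \<bar>x\<bar> \<le> 3 * R + N + 1 \<Longrightarrow> \<bar>y\<bar> \<le> 3 * R + N + 1 \<Longrightarrow> \<bar>p\<bar> \<le> 3 * R + N + 1 \<Longrightarrow> L (x, y, p) \<le> B"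
    and C: "0 \<le> C" "\<And>x y1 y2 p. \<bar>x\<bar> \<le> 3 * R + M \<Longrightarrow> \<bar>y1\<bar> \<le> 3 * R + M \<Longrightarrow> \<bar>y2\<bar> \<le> 3 * R + M \<Longrightarrow> \<bar>p\<bar> \<le> 3 * R + M
          \<Longrightarrow> \<bar>L (x, y1, p) - L (x, y2, p)\<bar> \<le> C * \<bar>y1 - y2\<bar>"
    and I: "I = (LINT x:{x\<in>{c..d}. M < \<bar>deriv u x\<bar>}|lebesgue. \<bar>deriv u x\<bar>)" "I \<le> R"
    and G: "G \<in> lmeasurable" "G \<subseteq> {c..d}" "\<And>x. x \<in> G \<Longrightarrow> \<bar>deriv u x\<bar> \<le> N"
      "measure lebesgue G = \<bar>LINT x:{x\<in>{c..d}. M < \<bar>deriv u x\<bar>}|lebesgue. deriv u x\<bar>"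
  shows "ereal ((LINT x:{x\<in>{c..d}. M < \<bar>deriv u x\<bar>}|lebesgue. L (x, u x, deriv u x))
      - (2 * C * (b - a) + 2 * B + m) * I) \<le> excess L u a b"
proof -
  let ?lu = "\<lambda>x. L (x, u x, deriv u x)"
  define S where "S = {x\<in>{c..d}. M < \<bar>deriv u x\<bar>}"
  define J where "J = (LINT x:S|lebesgue. deriv u x)"
  have D_meas [measurable]: "deriv u \<in> borel_measurable lebesgue"
    using u(2) by (rule borel_measurable_lebesgue_deriv)
  have S_sets [measurable]: "S \<in> sets lebesgue"
    unfolding S_def using u(2) by (rule sets_large_deriv)
  then have S_lm: "S \<in> lmeasurable"
    by (rule fmeasurableI2[of "{c..d}", rotated 2]) (auto simp: S_def)
  have G_sets [measurable]: "G \<in> sets lebesgue"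
    using G(1) by (rule fmeasurableD)
  have S_sub: "S \<subseteq> {a..b}" and G_sub: "G \<subseteq> {a..b}"
    using cd G(2) by (auto simp: S_def)
  have disj: "x \<notin> G" if "x \<in> S" for x
    using that G(3)[of x] M(2) by (auto simp: S_def)
  have int_lu_S: "set_integrable lebesgue S ?lu"
    using int_u S_sets S_sub by (rule set_integrable_subset)
  have int_D: "set_integrable lebesgue S (deriv u)"
    unfolding set_integrable_def
  proof (rule Bochner_Integration.integrable_bound)
    show "integrable lebesgue (\<lambda>x. indicat_real S x *\<^sub>R ?lu x)"
      using int_lu_S by (simp add: set_integrable_def)
    show "AE x in lebesgue. norm (indicat_real S x *\<^sub>R deriv u x) \<le> norm (indicat_real S x *\<^sub>R ?lu x)"
    proof (rule AE_I2)
      fix x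
      show "norm (indicat_real S x *\<^sub>R deriv u x) \<le> norm (indicat_real S x *\<^sub>R ?lu x)"
        using M(3)[of "deriv u x" x "u x"] by (auto simp: S_def indicator_def)
    qed
  qed measurable
  have I_eq: "I = (LINT x:S|lebesgue. \<bar>deriv u x\<bar>)"
    by (simp add: I(1) S_def)
  have J_le: "\<bar>J\<bar> \<le> I"
    using integral_norm_bound[of lebesgue "\<lambda>x. indicator S x *\<^sub>R deriv u x"]
    by (simp add: J_def I_eq set_lebesgue_integral_def abs_mult)
  have "0 \<le> I"
    using J_le by linarith
  have G_meas: "measure lebesgue G = \<bar>J\<bar>"
    by (simp add: G(4) J_def S_def)
  have S_meas: "measure lebesgue S \<le> I"
  proof -
    have "measure lebesgue S = (LINT x:S|lebesgue. 1)"
      using S_lm by (simp add: LINT_const)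
    also have "\<dots> \<le> (LINT x:S|lebesgue. \<bar>deriv u x\<bar>)"
      using M(1) by (intro set_integral_mono set_integrable_const S_lm set_integrable_abs int_D) (auto simp: S_def)
    finally show ?thesis
      by (simp add: I_eq)
  qed

  define h where "h x = sgn J * indicat_real G x - indicat_real S x * deriv u x" for x
  have int_G: "integrable lebesgue (\<lambda>x. sgn J * indicat_real G x)"
    using G(1) by (intro integrable_mult_right integrable_real_indicator) (auto simp: fmeasurable_def)
  have int_SD: "integrable lebesgue (\<lambda>x. indicat_real S x * deriv u x)"
    using int_D by (simp add: set_integrable_def)
  have int_h: "integrable lebesgue h"
    unfolding h_def using int_G int_SD by (rule Bochner_Integration.integrable_diff)
  have h_zero: "h x = 0" if "x \<notin> {c..d}" for x
    using that G(2) by (auto simp: h_def S_def indicator_def)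
  have LINT_h: "(LINT x|lebesgue. h x) = 0"
  proof -
    have "(LINT x|lebesgue. h x) = (LINT x|lebesgue. sgn J * indicat_real G x) - (LINT x|lebesgue. indicat_real S x * deriv u x)"
      unfolding h_def using int_G int_SD by (rule Bochner_Integration.integral_diff)
    also have "(LINT x|lebesgue. sgn J * indicat_real G x) = sgn J * \<bar>J\<bar>"
      using G_meas by simp
    also have "(LINT x|lebesgue. indicat_real S x * deriv u x) = J"
      by (simp add: J_def set_lebesgue_integral_def)
    finally show ?thesis
      by (simp add: sgn_mult_abs)
  qed
  define H where "H = primitive h"
  have H_left: "H x = 0" if "x \<le> c" for x
  proof -
    have "AE t in lebesgue. indicat_real {..x} t *\<^sub>R h t = 0"
      using AE_lebesgue_neq[of c] by eventually_elim (use that h_zero in \<open>auto simp: indicator_def\<close>)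
    then show ?thesis
      unfolding H_def primitive_def set_lebesgue_integral_def by (rule integral_eq_zero_AE)
  qed
  have H_right: "H x = 0" if "d \<le> x" for x
  proof -
    have "(\<lambda>t. indicat_real {..x} t *\<^sub>R h t) = h"
      using that h_zero by (force simp: indicator_def)
    then show ?thesis
      by (simp only: H_def primitive_def set_lebesgue_integral_def LINT_h)
  qed
  have H_bound: "\<bar>H x\<bar> \<le> 2 * I" for x
  proof -
    have "\<bar>H x\<bar> \<le> (LINT t|lebesgue. \<bar>indicat_real {..x} t *\<^sub>R h t\<bar>)"
      using integral_norm_bound[of lebesgue "\<lambda>t. indicat_real {..x} t *\<^sub>R h t"]
      by (simp add: H_def primitive_def set_lebesgue_integral_def)
    also have "\<dots> \<le> (LINT t|lebesgue. indicat_real G t + indicat_real S t *\<^sub>R \<bar>deriv u t\<bar>)"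
    proof (rule integral_mono)
      show "integrable lebesgue (\<lambda>t. \<bar>indicat_real {..x} t *\<^sub>R h t\<bar>)"
        using int_h by (intro integrable_abs integrable_mult_indicator) auto
      show "integrable lebesgue (\<lambda>t. indicat_real G t + indicat_real S t *\<^sub>R \<bar>deriv u t\<bar>)"
        using G(1) set_integrable_abs[OF int_D] unfolding set_integrable_def
        by (intro Bochner_Integration.integrable_add integrable_real_indicator) (auto simp: fmeasurable_def)
      show "\<bar>indicat_real {..x} t *\<^sub>R h t\<bar> \<le> indicat_real G t + indicat_real S t *\<^sub>R \<bar>deriv u t\<bar>" for t
        by (auto simp: h_def indicator_def sgn_if)
    qed
    also have "\<dots> = measure lebesgue G + I"
      unfolding I_eq set_lebesgue_integral_def using G(1) set_integrable_abs[OF int_D] unfolding set_integrable_def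
      by (subst Bochner_Integration.integral_add) (auto simp: fmeasurable_def intro!: integrable_real_indicator)
    finally show ?thesis
      using G_meas J_le by linarith
  qed

  define w where "w x = u x + H x" for x
  have w_AC: "w \<in> AC a b"
    unfolding w_def H_def by (intro AC_add u(1) AC_primitive int_h)
  have w_cont: "continuous_on UNIV w"
  proof -
    have "continuous_on UNIV H"
      unfolding H_def by (intro continuous_at_imp_continuous_on ballI isCont_primitive int_h)
    then show ?thesis
      unfolding w_def by (intro continuous_on_add u(2))
  qed
  have deriv_w: "AE x in lebesgue.
      deriv w x = (if u field_differentiable (at x) then deriv u x + h x else deriv u x)"
    using primitive_has_derivative_AE[OF int_h]
  proof eventually_elim
    case (elim x)
    then have "(H has_real_derivative h x) (at x)"
      by (simp add: H_def)
    from deriv_add_differentiable[OF this, of u] deriv_add_nondifferentiable[OF this, of u] show ?case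
      by (auto simp: w_def[abs_def])
  qed

  define g where "g x = 2 * C * I + (B + m) * indicat_real G x + indicat_real S x * (B - ?lu x)" for x
  have ineq: "AE x in lebesgue. x \<in> {a..b} \<longrightarrow> L (x, w x, deriv w x) \<le> ?lu x + g x"
    using deriv_w
  proof eventually_elim
    case (elim x)
    show ?case
    proof
      assume x: "x \<in> {a..b}"
      have x_le: "\<bar>x\<bar> \<le> R"
        using range x by (auto simp: abs_le_iff)
      have u_le: "\<bar>u x\<bar> \<le> R"
        using x by (rule u(3))
      have w_le: "\<bar>w x\<bar> \<le> 3 * R"
        using u_le H_bound[of x] I(2) unfolding w_def by linarith
      have "0 \<le> R" using x_le by linarith
      have CI: "0 \<le> 2 * C * I"
        using C(1) \<open>0 \<le> I\<close> by simp
      consider "x \<in> S" | "x \<in> G" | "x \<notin> S" "x \<notin> G" "x \<in> {c..d}" | "x \<notin> S" "x \<notin> G" "x \<notin> {c..d}"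
        by blast
      then show "L (x, w x, deriv w x) \<le> ?lu x + g x"
      proof cases
        case 1
        then have "u field_differentiable (at x)"
          using default(2)[of u x] M(2) by (force simp: S_def)
        then have "deriv w x = 0"
          using elim 1 disj[OF 1] by (simp add: h_def)
        then have "L (x, w x, deriv w x) \<le> B"
          using x_le w_le \<open>0 \<le> R\<close> default(1) by (intro B(2)) auto
        then show ?thesis
          using 1 disj[OF 1] CI by (simp add: g_def)
      next
        case 2
        then have "x \<notin> S"
          using disj by blast
        have "\<bar>deriv w x\<bar> \<le> N + 1"
          using elim 2 \<open>x \<notin> S\<close> G(3)[OF 2] by (auto simp: h_def sgn_if split: if_splits)
        then have "L (x, w x, deriv w x) \<le> B"
          using x_le w_le \<open>0 \<le> R\<close> default(1) by (intro B(2)) auto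
        then show ?thesis
          using 2 \<open>x \<notin> S\<close> CI m(2)[of "(x, u x, deriv u x)"] by (simp add: g_def)
      next
        case 3
        then have D: "deriv w x = deriv u x" "\<bar>deriv u x\<bar> \<le> M"
          using elim by (auto simp: h_def S_def)
        then have "\<bar>L (x, w x, deriv u x) - L (x, u x, deriv u x)\<bar> \<le> C * \<bar>w x - u x\<bar>"
          using x_le w_le u_le \<open>0 \<le> R\<close> M(1) by (intro C(2)) auto
        also have "\<dots> \<le> C * (2 * I)"
          using H_bound[of x] C(1) by (intro mult_left_mono) (auto simp: w_def)
        finally show ?thesis
          using 3 D by (simp add: g_def)
      next
        case 4
        then have "deriv w x = deriv u x"
          using elim h_zero by auto
        moreover have "w x = u x"
          using 4 H_left[of x] H_right[of x] by (force simp: w_def)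
        ultimately show ?thesis
          using 4 CI by (simp add: g_def)
      qed
    qed
  qed
  have int1: "set_integrable lebesgue {a..b} (\<lambda>x. 2 * C * I)"
    by (rule set_integrable_const) simp
  have ind2: "indicat_real {a..b} x *\<^sub>R ((B + m) * indicat_real G x) = indicat_real G x *\<^sub>R (B + m)" for x
    using G_sub by (auto simp: indicator_def)
  have ind3: "indicat_real {a..b} x *\<^sub>R (indicat_real S x * (B - ?lu x)) = indicat_real S x *\<^sub>R (B - ?lu x)" for x
    using S_sub by (auto simp: indicator_def)
  have int_S: "set_integrable lebesgue S (\<lambda>x. B - ?lu x)"
    using set_integrable_const[OF S_lm] int_lu_S by (rule set_integral_diff)
  have int2: "set_integrable lebesgue {a..b} (\<lambda>x. (B + m) * indicat_real G x)"
    using set_integrable_const[OF G(1), of "B + m"] by (simp only: set_integrable_def ind2)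
  have int3: "set_integrable lebesgue {a..b} (\<lambda>x. indicat_real S x * (B - ?lu x))"
    using int_S by (simp only: set_integrable_def ind3)
  have int12: "set_integrable lebesgue {a..b} (\<lambda>x. 2 * C * I + (B + m) * indicat_real G x)"
    using int1 int2 by (rule set_integral_add)
  have int_g: "set_integrable lebesgue {a..b} g"
    unfolding g_def using int12 int3 by (rule set_integral_add)
  have LINT2: "(LINT x:{a..b}|lebesgue. (B + m) * indicat_real G x) = (B + m) * measure lebesgue G"
    using LINT_const[OF G(1), of "B + m"] by (simp only: set_lebesgue_integral_def ind2)
  have "(LINT x:{a..b}|lebesgue. indicat_real S x * (B - ?lu x)) = (LINT x:S|lebesgue. B - ?lu x)"
    by (simp only: set_lebesgue_integral_def ind3)
  also have "\<dots> = B * measure lebesgue S - (LINT x:S|lebesgue. ?lu x)"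
    by (subst set_integral_diff(2)[OF set_integrable_const[OF S_lm] int_lu_S]) (simp add: LINT_const[OF S_lm])
  finally have LINT3: "(LINT x:{a..b}|lebesgue. indicat_real S x * (B - ?lu x))
      = B * measure lebesgue S - (LINT x:S|lebesgue. ?lu x)" .
  have "(LINT x:{a..b}|lebesgue. g x)
      = 2 * C * I * (b - a) + (B + m) * measure lebesgue G + (B * measure lebesgue S - (LINT x:S|lebesgue. ?lu x))"
    unfolding g_def set_integral_add(2)[OF int12 int3] set_integral_add(2)[OF int1 int2] LINT2 LINT3
    using cd by (simp add: LINT_const)
  also have "\<dots> \<le> 2 * C * I * (b - a) + (B + m) * I + (B * I - (LINT x:S|lebesgue. ?lu x))"
  proof -
    have "(B + m) * measure lebesgue G \<le> (B + m) * I" "B * measure lebesgue S \<le> B * I"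
      using G_meas J_le S_meas B(1) m(1) by (auto intro!: mult_left_mono)
    then show ?thesis
      by linarith
  qed
  finally have "(LINT x:S|lebesgue. ?lu x) - (2 * C * (b - a) + 2 * B + m) * I \<le> - (LINT x:{a..b}|lebesgue. g x)"
    by (simp add: algebra_simps)
  moreover have "ereal (- (LINT x:{a..b}|lebesgue. g x)) \<le> excess L u a b"
    using cd by (intro excess_lower_bound[OF L int_u w_AC w_cont _ _ int_g ineq]) (auto simp: w_def H_left H_right)
  ultimately show ?thesis
    unfolding S_def[symmetric] by (meson ereal_less_eq(3) order_trans)
qed

section \<open>Large derivatives are controlled by the excess\<close>

theorem corollary2p21:
  fixes L :: "real \<times> real \<times> real \<Rightarrow> real"
  assumes "lagrangian L"
    and "loc_lipschitz_in_y L"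
  shows "\<forall>R>0. \<exists>M>0. \<exists>\<delta>>0. \<forall>a b \<alpha> \<beta> u.
    {\<alpha>..\<beta>} \<subseteq> {a..b} \<and> {a..b} \<subseteq> {-R..R} \<and> \<alpha> < \<beta> \<and> \<bar>b - a\<bar> < \<delta> \<and>
    u \<in> AC a b \<and> (\<forall>x\<in>{a..b}. \<bar>u x\<bar> \<le> R) \<and>
    excess L u a b + ereal \<bar>u \<beta> - u \<alpha>\<bar> \<le> ereal (R * (\<beta> - \<alpha>)) \<longrightarrow>
    ext_integral {x \<in> {a..b}. \<bar>deriv u x\<bar> > M} (\<lambda>x. L (x, u x, deriv u x)) \<le> 2 * excess L u a b"
proof (intro allI impI)
  fix R :: real assume "0 < R"
  note L = assms(1)
  obtain m where m: "0 \<le> m" "\<And>z. - m \<le> L z"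
    using lagrangian_lower_bound[OF L] by blast
  obtain j where j: "\<And>f x. \<not> f field_differentiable (at x) \<Longrightarrow> deriv f x = (j :: real)"
    using deriv_default[where 'a = real] by blast
  obtain B0 where B0: "0 \<le> B0" "\<And>x y p. \<bar>x\<bar> \<le> R \<Longrightarrow> \<bar>y\<bar> \<le> R \<Longrightarrow> \<bar>p\<bar> \<le> R \<Longrightarrow> L (x, y, p) \<le> B0"
    using lagrangian_bounded_on_boxes[OF L, where N = R] by blast
  obtain P1 where P1: "1 \<le> P1" "\<And>x y p. P1 \<le> \<bar>p\<bar> \<Longrightarrow> 1 * \<bar>p\<bar> \<le> L (x, y, p)"
    using lagrangian_growth[OF L, where K = 1] by blast
  \<comment> \<open>\<open>Q\<close> bounds the mean of \<open>L + m\<close> over \<open>{\<alpha>..\<beta>}\<close>, by comparison with the chord.\<close>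
  define Q where "Q = R + B0 + m"
  have Q: "0 < Q"
    using \<open>0 < R\<close> B0(1) m(1) by (simp add: Q_def)
  \<comment> \<open>\<open>N \<ge> 2 * Q\<close> leaves half of \<open>{\<alpha>..\<beta>}\<close> for slopes up to \<open>N\<close>; \<open>N \<ge> \<bar>j\<bar>\<close> covers the default slope.\<close>
  define N where "N = max P1 (max (2 * Q) \<bar>j\<bar>)"
  have N: "P1 \<le> N" "2 * Q \<le> N" "\<bar>j\<bar> \<le> N" "1 \<le> N"
    using P1(1) by (auto simp: N_def)
  obtain B where B: "0 \<le> B" "\<And>x y p. \<bar>x\<bar> \<le> 3 * R + N + 1 \<Longrightarrow> \<bar>y\<bar> \<le> 3 * R + N + 1 \<Longrightarrow> \<bar>p\<bar> \<le> 3 * R + N + 1 \<Longrightarrow> L (x, y, p) \<le> B"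
    using lagrangian_bounded_on_boxes[OF L, where N = "3 * R + N + 1"] by blast
  \<comment> \<open>The first summand makes the cost of the competitor at most half of the gain; the second makes
    \<open>\<Phi> \<alpha> \<beta>\<close> less than \<open>(\<beta> - \<alpha>) / 2\<close>; the third gives the contradiction in the continuity argument.\<close>
  define K where "K = 2 * (1 + 2 * B + m) + 4 * Q + 4 * R"
  have K: "2 * (1 + 2 * B + m) \<le> K" "4 * Q < K" "4 * R < K" "1 \<le> K"
    using Q \<open>0 < R\<close> B(1) m(1) by (auto simp: K_def)
  obtain P where P: "1 \<le> P" "\<And>x y p. P \<le> \<bar>p\<bar> \<Longrightarrow> K * \<bar>p\<bar> \<le> L (x, y, p)"
    using lagrangian_growth[OF L, where K = K] by blast
  define M where "M = max P N"
  have M: "P \<le> M" "N \<le> M" "1 \<le> M"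
    using P(1) by (auto simp: M_def)
  have "0 < 3 * R + M"
    using \<open>0 < R\<close> M by simp
  then obtain C where C: "0 \<le> C" "\<And>x y1 y2 p. \<bar>x\<bar> \<le> 3 * R + M \<and> \<bar>y1\<bar> \<le> 3 * R + M \<and> \<bar>y2\<bar> \<le> 3 * R + M \<and> \<bar>p\<bar> \<le> 3 * R + M
          \<Longrightarrow> \<bar>L (x, y1, p) - L (x, y2, p)\<bar> \<le> C * \<bar>y1 - y2\<bar>"
    using assms(2) unfolding loc_lipschitz_in_y_def by meson
  define \<delta> where "\<delta> = 1 / (2 * C + 1)"
  have "0 < \<delta>"
    using C(1) by (simp add: \<delta>_def)
  have growth: "K * \<bar>p\<bar> \<le> L (x, y, p)" if "M < \<bar>p\<bar>" for x y p
    using that M(1) by (intro P(2)) auto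

  have cont_case: "ext_integral {x \<in> {a..b}. \<bar>deriv u x\<bar> > M} (\<lambda>x. L (x, u x, deriv u x)) \<le> 2 * excess L u a b"
    if ab: "{\<alpha>..\<beta>} \<subseteq> {a..b}" "{a..b} \<subseteq> {-R..R}" "\<alpha> < \<beta>" "\<bar>b - a\<bar> < \<delta>"
      and u: "u \<in> AC a b" "continuous_on UNIV u" "\<And>x. x \<in> {a..b} \<Longrightarrow> \<bar>u x\<bar> \<le> R"
      and small: "excess L u a b + ereal \<bar>u \<beta> - u \<alpha>\<bar> \<le> ereal (R * (\<beta> - \<alpha>))"
    for a b \<alpha> \<beta> u
  proof -
    let ?lu = "\<lambda>x. L (x, u x, deriv u x)"
    define S where "S c d = {x \<in> {c..d}. M < \<bar>deriv u x\<bar>}" for c d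
    have order: "a \<le> \<alpha>" "\<beta> \<le> b" "- R \<le> a" "b \<le> R"
      using ab by (auto simp: atLeastatMost_subset_iff)
    have S_sets: "S c d \<in> sets lebesgue" for c d
      unfolding S_def using u(2) by (rule sets_large_deriv)
    have "excess L u a b \<noteq> \<infinity>"
      using small by auto
    then have "action L u a b \<noteq> \<infinity>"
      by (auto simp: excess_def)
    with L u(2) have int_u: "set_integrable lebesgue {a..b} ?lu"
      by (rule set_integrable_integrand)
    have "ereal (- (LINT x:{a..b}|lebesgue. 0)) \<le> excess L u a b"
      by (rule excess_lower_bound[OF L int_u u(1,2)]) auto
    then have "0 \<le> excess L u a b"
      by (simp add: zero_ereal_def)
    then obtain e where e: "excess L u a b = ereal e" "0 \<le> e"
      using \<open>excess L u a b \<noteq> \<infinity>\<close> by (cases "excess L u a b") auto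
    have small': "e + \<bar>u \<beta> - u \<alpha>\<bar> \<le> R * (\<beta> - \<alpha>)"
      using small by (simp add: e)

    have "ereal ((LINT x:{\<alpha>..\<beta>}|lebesgue. ?lu x) - B0 * (\<beta> - \<alpha>)) \<le> excess L u a b"
      using order ab(3) small' e(2)
      by (intro action_on_subinterval_le[where R = R] L u int_u B0) auto
    then have "(LINT x:{\<alpha>..\<beta>}|lebesgue. ?lu x) \<le> (R + B0) * (\<beta> - \<alpha>)"
      using small' by (simp add: e algebra_simps)
    then have mid: "(LINT x:{\<alpha>..\<beta>}|lebesgue. ?lu x) + m * measure lebesgue {\<alpha>..\<beta>} \<le> Q * (\<beta> - \<alpha>)"
      using ab(3) by (simp add: Q_def algebra_simps)
    have int_mid: "set_integrable lebesgue {\<alpha>..\<beta>} ?lu"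
      using int_u by (rule set_integrable_subset) (use ab in auto)
    have mid_sub: "(LINT x:A|lebesgue. ?lu x) \<le> Q * (\<beta> - \<alpha>)" if "A \<in> sets lebesgue" "A \<subseteq> {\<alpha>..\<beta>}" for A
      using LINT_lower_bound_on_subset[OF int_mid m(2) m(1) _ that] mid by simp

    define A where "A = {x \<in> {\<alpha>..\<beta>}. \<bar>deriv u x\<bar> \<le> N}"
    have A: "A \<in> lmeasurable" "A \<subseteq> {\<alpha>..\<beta>}" "(\<beta> - \<alpha>) / 2 \<le> measure lebesgue A"
    proof -
      define A' where "A' = {x \<in> {\<alpha>..\<beta>}. N < \<bar>deriv u x\<bar>}"
      have A'_sets: "A' \<in> sets lebesgue"
        unfolding A'_def using u(2) by (rule sets_large_deriv)
      then have A': "A' \<in> lmeasurable"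
        by (rule fmeasurableI2[of "{\<alpha>..\<beta>}", rotated 2]) (auto simp: A'_def)
      have "N * measure lebesgue A' = (LINT x:A'|lebesgue. N)"
        using A' by (simp add: LINT_const)
      also have "\<dots> \<le> (LINT x:A'|lebesgue. ?lu x)"
      proof (rule set_integral_mono)
        show "set_integrable lebesgue A' ?lu"
          using int_mid A'_sets by (rule set_integrable_subset) (auto simp: A'_def)
        show "N \<le> ?lu x" if "x \<in> A'" for x
          using that N(1) P1(2)[of "deriv u x" x "u x"] by (auto simp: A'_def)
      qed (rule set_integrable_const[OF A'])
      also have "\<dots> \<le> Q * (\<beta> - \<alpha>)"
        using A'_sets by (rule mid_sub) (auto simp: A'_def)
      also have "\<dots> \<le> N / 2 * (\<beta> - \<alpha>)"
        using N(2) ab(3) by (intro mult_right_mono) auto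
      finally have "N * measure lebesgue A' \<le> N * ((\<beta> - \<alpha>) / 2)"
        by simp
      then have half: "measure lebesgue A' \<le> (\<beta> - \<alpha>) / 2"
        using N(4) by (subst (asm) mult_le_cancel_left_pos) auto
      have A_eq: "A = {\<alpha>..\<beta>} - A'"
        by (auto simp: A_def A'_def)
      show "A \<in> lmeasurable"
        unfolding A_eq using A'_sets by (intro fmeasurable_Diff) auto
      have "measure lebesgue A = measure lebesgue {\<alpha>..\<beta>} - measure lebesgue A'"
        unfolding A_eq using A' A'_sets by (intro measurable_measure_Diff) (auto simp: A'_def)
      then show "(\<beta> - \<alpha>) / 2 \<le> measure lebesgue A"
        using half ab(3) by (simp add: field_simps)
    qed (auto simp: A_def)

    define f where "f x = indicat_real (S a b) x * \<bar>deriv u x\<bar>" for x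
    have int_lu_S: "set_integrable lebesgue (S a b) ?lu"
      using int_u S_sets by (rule set_integrable_subset) (auto simp: S_def)
    have D_meas: "deriv u \<in> borel_measurable lebesgue"
      using u(2) by (rule borel_measurable_lebesgue_deriv)
    have int_f: "integrable lebesgue f"
    proof (rule Bochner_Integration.integrable_bound)
      show "integrable lebesgue (\<lambda>x. indicat_real (S a b) x *\<^sub>R ?lu x)"
        using int_lu_S by (simp add: set_integrable_def)
      show "f \<in> borel_measurable lebesgue"
        unfolding f_def using S_sets D_meas
        by (intro borel_measurable_times borel_measurable_abs borel_measurable_indicator)
      show "AE x in lebesgue. norm (f x) \<le> norm (indicat_real (S a b) x *\<^sub>R ?lu x)"
      proof (rule AE_I2)
        fix x
        have "\<bar>deriv u x\<bar> \<le> ?lu x" if "x \<in> S a b"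
        proof -
          have "1 * \<bar>deriv u x\<bar> \<le> K * \<bar>deriv u x\<bar>"
            using K(4) by (rule mult_right_mono) simp
          also have "\<dots> \<le> ?lu x"
            using that by (intro growth) (simp add: S_def)
          finally show ?thesis by simp
        qed
        then show "norm (f x) \<le> norm (indicat_real (S a b) x *\<^sub>R ?lu x)"
          by (auto simp: f_def indicator_def)
      qed
    qed
    define \<Phi> where "\<Phi> c d = (LINT x:S c d|lebesgue. \<bar>deriv u x\<bar>)" for c d
    have \<Phi>_eq: "\<Phi> c d = primitive f d - primitive f c" if "a \<le> c" "c \<le> d" "d \<le> b" for c d
    proof -
      have "indicat_real (S c d) x * \<bar>deriv u x\<bar> = indicat_real {c..d} x * f x" for x
        using that by (auto simp: f_def S_def indicator_def)
      then show ?thesis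
        using primitive_diff[OF int_f that(2)] by (simp add: \<Phi>_def set_lebesgue_integral_def)
    qed
    have \<Phi>_growth: "K * \<Phi> c d \<le> (LINT x:S c d|lebesgue. ?lu x)" if "a \<le> c" "c \<le> d" "d \<le> b" for c d
    proof -
      have sub: "S c d \<subseteq> S a b"
        using that by (auto simp: S_def)
      have "set_integrable lebesgue (S a b) (\<lambda>x. \<bar>deriv u x\<bar>)"
        using int_f by (simp add: set_integrable_def f_def[abs_def])
      then have int_D: "set_integrable lebesgue (S c d) (\<lambda>x. \<bar>deriv u x\<bar>)"
        using S_sets sub by (rule set_integrable_subset)
      have "K * \<Phi> c d = (LINT x:S c d|lebesgue. K * \<bar>deriv u x\<bar>)"
        by (simp add: \<Phi>_def)
      also have "\<dots> \<le> (LINT x:S c d|lebesgue. ?lu x)"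
      proof (rule set_integral_mono)
        show "set_integrable lebesgue (S c d) ?lu"
          using int_lu_S S_sets sub by (rule set_integrable_subset)
        show "set_integrable lebesgue (S c d) (\<lambda>x. K * \<bar>deriv u x\<bar>)"
          using int_D by simp
        show "K * \<bar>deriv u x\<bar> \<le> ?lu x" if "x \<in> S c d" for x
          using that by (intro growth) (simp add: S_def)
      qed
      finally show ?thesis .
    qed

    \<comment> \<open>As long as \<open>\<Phi> c d\<close> is at most half of \<open>\<beta> - \<alpha>\<close>, there is room for the set \<open>G\<close>.\<close>
    have step: "(LINT x:S c d|lebesgue. ?lu x) \<le> 2 * e"
      if cd: "a \<le> c" "c \<le> \<alpha>" "\<beta> \<le> d" "d \<le> b" and half: "\<Phi> c d \<le> (\<beta> - \<alpha>) / 2" for c d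
    proof -
      have "\<bar>LINT x:S c d|lebesgue. deriv u x\<bar> \<le> \<Phi> c d"
        using integral_norm_bound[of lebesgue "\<lambda>x. indicator (S c d) x *\<^sub>R deriv u x"]
        by (simp add: \<Phi>_def set_lebesgue_integral_def abs_mult)
      then have J_le: "\<bar>LINT x:S c d|lebesgue. deriv u x\<bar> \<le> measure lebesgue A"
        using half A(3) by linarith
      obtain G where G: "G \<in> lmeasurable" "G \<subseteq> A" "measure lebesgue G = \<bar>LINT x:S c d|lebesgue. deriv u x\<bar>"
        using subset_of_given_measure[OF A(1,2) abs_ge_zero J_le less_imp_le[OF ab(3)]] by blast
      have "0 \<le> \<Phi> c d"
        using \<open>\<bar>LINT x:S c d|lebesgue. deriv u x\<bar> \<le> \<Phi> c d\<close> by linarith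
      have "ereal ((LINT x:S c d|lebesgue. ?lu x) - (2 * C * (b - a) + 2 * B + m) * \<Phi> c d) \<le> excess L u a b"
        unfolding S_def
      proof (rule truncation_competitor[where N = N and R = R, OF L m _ _ u int_u _ _ _ ab(2) M(3) M(2) _ B C(1) _ _ _ G(1)])
        show "\<bar>deriv f x :: real\<bar> \<le> N" if "\<not> f field_differentiable (at x)" for f x
          using j[OF that] N(3) by simp
        show "\<bar>p\<bar> \<le> L (x, y, p)" if "M < \<bar>p\<bar>" for x y p
          using that N(1) M(2) P1(2)[of p x y] by simp
        show "\<Phi> c d \<le> R"
          using half order ab(3) by (simp add: field_simps)
        show "G \<subseteq> {c..d}"
          using G(2) cd by (auto simp: A_def)
        show "\<bar>deriv u x\<bar> \<le> N" if "x \<in> G" for x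
          using that G(2) by (auto simp: A_def)
      qed (use N cd ab(3) G(3) C(2) in \<open>auto simp: \<Phi>_def S_def\<close>)
      then have le: "(LINT x:S c d|lebesgue. ?lu x) - (2 * C * (b - a) + 2 * B + m) * \<Phi> c d \<le> e"
        by (simp add: e)
      have "2 * C * (b - a) \<le> 2 * C * \<delta>"
        using ab(4) C(1) by (intro mult_left_mono) auto
      also have "\<dots> \<le> 1"
        using C(1) by (simp add: \<delta>_def)
      finally have "2 * C * (b - a) + 2 * B + m \<le> K / 2"
        using K(1) by simp
      then have "(2 * C * (b - a) + 2 * B + m) * \<Phi> c d \<le> K / 2 * \<Phi> c d"
        using \<open>0 \<le> \<Phi> c d\<close> by (rule mult_right_mono)
      then have "(2 * C * (b - a) + 2 * B + m) * \<Phi> c d \<le> (LINT x:S c d|lebesgue. ?lu x) / 2"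
        using \<Phi>_growth[of c d] cd ab(3) by simp
      then show ?thesis
        using le by simp
    qed

    have "\<Phi> a b \<le> (\<beta> - \<alpha>) / 2"
    proof (rule ccontr)
      assume large: "\<not> \<Phi> a b \<le> (\<beta> - \<alpha>) / 2"
      \<comment> \<open>Let \<open>{c..d}\<close> grow from \<open>{\<alpha>..\<beta>}\<close> to \<open>{a..b}\<close>.  Then \<open>\<Phi> c d\<close> cannot reach the value
        \<open>(\<beta> - \<alpha>) / 2\<close>: there \<open>step\<close> would bound it by \<open>2 * R * (\<beta> - \<alpha>) / K\<close>, which is smaller.\<close>
      define \<phi> where "\<phi> t = primitive f (\<beta> + t * (b - \<beta>)) - primitive f (\<alpha> - t * (\<alpha> - a))" for t
      have "\<exists>t\<ge>0. t \<le> 1 \<and> \<phi> t = (\<beta> - \<alpha>) / 2"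
      proof (rule IVT)
        have "K * \<Phi> \<alpha> \<beta> \<le> (LINT x:S \<alpha> \<beta>|lebesgue. ?lu x)"
          using order ab(3) by (intro \<Phi>_growth) auto
        also have "\<dots> \<le> Q * (\<beta> - \<alpha>)"
          by (rule mid_sub[OF S_sets]) (auto simp: S_def)
        also have "\<dots> \<le> K / 4 * (\<beta> - \<alpha>)"
          using K(2) ab(3) by (intro mult_right_mono) auto
        finally have "K * \<Phi> \<alpha> \<beta> \<le> K * ((\<beta> - \<alpha>) / 4)"
          by simp
        then have "\<Phi> \<alpha> \<beta> \<le> (\<beta> - \<alpha>) / 4"
          using K(4) by (subst (asm) mult_le_cancel_left_pos) auto
        then show "\<phi> 0 \<le> (\<beta> - \<alpha>) / 2"
          using order ab(3) \<Phi>_eq[of \<alpha> \<beta>] by (simp add: \<phi>_def)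
        show "(\<beta> - \<alpha>) / 2 \<le> \<phi> 1"
          using large order ab(3) \<Phi>_eq[of a b] by (simp add: \<phi>_def)
        show "\<forall>t. 0 \<le> t \<and> t \<le> 1 \<longrightarrow> isCont \<phi> t"
          unfolding \<phi>_def
          by (intro allI impI continuous_intros isCont_o2[OF _ isCont_primitive[OF int_f]])
      qed simp
      then obtain t where t: "0 \<le> t" "t \<le> 1" "\<phi> t = (\<beta> - \<alpha>) / 2"
        by blast
      define c d where "c = \<alpha> - t * (\<alpha> - a)" and "d = \<beta> + t * (b - \<beta>)"
      have cd: "a \<le> c" "c \<le> \<alpha>" "\<beta> \<le> d" "d \<le> b"
        using t order mult_left_le_one_le[of "\<alpha> - a" t] mult_left_le_one_le[of "b - \<beta>" t]
        by (auto simp: c_def d_def)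
      then have eq: "\<Phi> c d = (\<beta> - \<alpha>) / 2"
        using t(3) ab(3) by (subst \<Phi>_eq) (auto simp: \<phi>_def c_def d_def)
      have "K * ((\<beta> - \<alpha>) / 2) \<le> (LINT x:S c d|lebesgue. ?lu x)"
        using \<Phi>_growth[of c d] cd ab(3) by (simp add: eq)
      also have "\<dots> \<le> 2 * e"
        using cd eq by (intro step) auto
      also have "\<dots> \<le> 2 * R * (\<beta> - \<alpha>)"
        using small' by simp
      also have "\<dots> < K / 2 * (\<beta> - \<alpha>)"
        using K(3) ab(3) by (intro mult_strict_right_mono) auto
      finally show False
        by simp
    qed
    then have "(LINT x:S a b|lebesgue. ?lu x) \<le> 2 * e"
      using order by (intro step) auto
    then show ?thesis
      using ext_integral_eq_LINT[OF int_lu_S] by (simp add: e S_def)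
  qed

  show "\<exists>M>0. \<exists>\<delta>>0. \<forall>a b \<alpha> \<beta> u.
    {\<alpha>..\<beta>} \<subseteq> {a..b} \<and> {a..b} \<subseteq> {-R..R} \<and> \<alpha> < \<beta> \<and> \<bar>b - a\<bar> < \<delta> \<and>
    u \<in> AC a b \<and> (\<forall>x\<in>{a..b}. \<bar>u x\<bar> \<le> R) \<and>
    excess L u a b + ereal \<bar>u \<beta> - u \<alpha>\<bar> \<le> ereal (R * (\<beta> - \<alpha>)) \<longrightarrow>
    ext_integral {x \<in> {a..b}. \<bar>deriv u x\<bar> > M} (\<lambda>x. L (x, u x, deriv u x)) \<le> 2 * excess L u a b"
  proof (rule exI[of _ M], rule conjI[OF _ exI[of _ \<delta>]], goal_cases)
    case 1
    show ?case
      using M(3) by simp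
  next
    case 2
    show ?case
    proof (intro conjI allI impI, goal_cases)
      case 1
      show ?case
        by fact
    next
      case (2 a b \<alpha> \<beta> u)
      then have ab: "{\<alpha>..\<beta>} \<subseteq> {a..b}" "{a..b} \<subseteq> {-R..R}" "\<alpha> < \<beta>" "\<bar>b - a\<bar> < \<delta>"
        and u: "u \<in> AC a b" "\<And>x. x \<in> {a..b} \<Longrightarrow> \<bar>u x\<bar> \<le> R"
        and small: "excess L u a b + ereal \<bar>u \<beta> - u \<alpha>\<bar> \<le> ereal (R * (\<beta> - \<alpha>))"
        by auto
      have mem: "\<alpha> \<in> {a..b}" "\<beta> \<in> {a..b}"
        using ab by auto
      then have "a \<le> b"
        by auto
      obtain w where w: "w \<in> AC a b" "continuous_on UNIV w" "\<And>x. x \<in> {a..b} \<Longrightarrow> w x = u x"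
          "\<And>x. x \<in> {a<..<b} \<Longrightarrow> deriv w x = deriv u x"
        using AC_continuous_extension[OF u(1) \<open>a \<le> b\<close>] by blast
      note same = excess_eq_of_eq_on(1)[where L = L, OF w(3,4) \<open>a \<le> b\<close>]
        excess_eq_of_eq_on(2)[where L = L and M = M, OF w(3,4) \<open>a \<le> b\<close>]
      have "ext_integral {x \<in> {a..b}. \<bar>deriv w x\<bar> > M} (\<lambda>x. L (x, w x, deriv w x)) \<le> 2 * excess L w a b"
      proof (rule cont_case[OF ab w(1,2)])
        show "\<bar>w x\<bar> \<le> R" if "x \<in> {a..b}" for x
          using w(3)[OF that] u(2)[OF that] by simp
        show "excess L w a b + ereal \<bar>w \<beta> - w \<alpha>\<bar> \<le> ereal (R * (\<beta> - \<alpha>))"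
          using small w(3)[OF mem(1)] w(3)[OF mem(2)] same(1) by simp
      qed
      then show ?case
        by (simp only: same)
    qed
  qed
qed

end
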